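(* Assume (W) and $(A_{\epsilon,R})$ hold and $\lambda>0$. Let $u(x)=u(|x|)$ be a nontrivial radially symmetric weak solution of $$-\operatorname{div}(v(|x|)|\nabla u|^{p-2}\nabla u)=\lambda w(|x|)|u|^{p-2}u\quad\text{in }A_{R_1}^{R_2}$$ belonging to $\mathcal D_0^{1,p}(A_{R_1}^{R_2};v)\cap C^1(A_{R_1}^{R_2})$, with $\lim_{r\to R_1^+}u(r)=0$ and $\lim_{r\to R_2^-}u(r)=0$. Then there exist $b\in(R_1,R_2)$ and constants $0<C_1<C_2$, $0<\tilde C_1<\tilde C_2$ such that for all $r\in(b,R_2)$, $$C_1\int_r^{R_2}\rho^{1-p'}(\tau)d\tau\le|u(r)|\le C_2\int_r^{R_2}\rho^{1-p'}(\tau)d\tau,\qquad \tilde C_1\rho^{1-p'}(r)\le|u'(r)|\le\tilde C_2\rho^{1-p'}(r).$$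
   Context: Let $N\ge 2$, $1<p<\infty$, $p'=p/(p-1)$, $0<R_1<R_2\le\infty$, $A_{R_1}^{R_2}=\{x\in\mathbb R^N:R_1<|x|<R_2\}$. $\rho(r)=r^{N-1}v(r)$, $\sigma(r)=r^{N-1}w(r)$. (W): $v,w$ are positive a.e. in $(R_1,R_2)$, $v$ is continuous and $w$ measurable on $(R_1,R_2)$, $v^{-1/(p-1)}\in L^1_{\mathrm{loc}}(R_1,R_2)$ and $w\in L^1_{\mathrm{loc}}(R_1,R_2)$. $(A_{\epsilon,R})$: there exists $\xi\in(R_1,R_2)$ with $\rho^{1-p'}\in L^1(\xi,R_2)$, and there exist $\epsilon\in(0,p-1)$ and $C>0$ such that $\big(\int_\xi^r\sigma(\tau)d\tau\big)\big(\int_r^{R_2}\rho^{1-p'}(\tau)d\tau\big)^\epsilon<C$ for all $r\in(\xi,R_2)$. $\mathcal D_0^{1,p}(A_{R_1}^{R_2};v)$: completion of $C_c^1(A_{R_1}^{R_2})$ in the norm $(\int v(|x|)|\nabla u|^p dx)^{1/p}$; a weak solution is $u$ in this space with $\int v(|x|)|\nabla u|^{p-2}\nabla u\cdot\nabla\phi=\lambda\int w(|x|)|u|^{p-2}u\phi$ for all $\phi$ in the space. For radial $u$ one writes $u(r)$, $r=|x|$. *)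

theory Defs
  imports "HOL-Analysis.Analysis"
begin

definition ivl :: "real \<Rightarrow> ereal \<Rightarrow> real set" where
  "ivl a R2 = {r. a < r \<and> ereal r < R2}"

definition upper_filter :: "ereal \<Rightarrow> real filter" where
  "upper_filter R2 = (if R2 = \<infinity> then at_top else at_left (real_of_ereal R2))"

definition annulus :: "real \<Rightarrow> ereal \<Rightarrow> (real^'n) set" where
  "annulus R1 R2 = {x. R1 < norm x \<and> ereal (norm x) < R2}"

definition grad :: "(real^'n \<Rightarrow> real) \<Rightarrow> real^'n \<Rightarrow> real^'n" where
  "grad f x = (\<chi> i. frechet_derivative f (at x) (axis i 1))"

definition C1_on :: "(real^'n) set \<Rightarrow> (real^'n \<Rightarrow> real) \<Rightarrow> bool" where
  "C1_on S f \<longleftrightarrow> (\<forall>x\<in>S. f differentiable (at x)) \<and> continuous_on S (grad f)"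

definition Cc1 :: "(real^'n) set \<Rightarrow> (real^'n \<Rightarrow> real) \<Rightarrow> bool" where
  "Cc1 S f \<longleftrightarrow> C1_on UNIV f \<and> (\<exists>K. compact K \<and> K \<subseteq> S \<and> (\<forall>x. x \<notin> K \<longrightarrow> f x = 0))"

text \<open>Membership of a C^1 function u in D_0^{1,p}(S; v): u is the limit of a sequence of
  C_c^1(S) functions in the weighted gradient norm (identified with u through L^1_loc convergence).\<close>
definition in_D0 :: "real \<Rightarrow> (real \<Rightarrow> real) \<Rightarrow> (real^'n) set \<Rightarrow> (real^'n \<Rightarrow> real) \<Rightarrow> bool" where
  "in_D0 p v S u \<longleftrightarrow>
     set_integrable lebesgue S (\<lambda>x. v (norm x) * norm (grad u x) powr p) \<and>
     (\<exists>\<phi> :: nat \<Rightarrow> real^'n \<Rightarrow> real.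
        (\<forall>k. Cc1 S (\<phi> k)) \<and>
        ((\<lambda>k. set_lebesgue_integral lebesgue S
                 (\<lambda>x. v (norm x) * norm (grad (\<phi> k) x - grad u x) powr p)) \<longlonglongrightarrow> 0) \<and>
        (\<forall>K. compact K \<and> K \<subseteq> S \<longrightarrow>
           ((\<lambda>k. set_lebesgue_integral lebesgue K (\<lambda>x. \<bar>\<phi> k x - u x\<bar>)) \<longlonglongrightarrow> 0)))"

definition weak_solution ::
  "real \<Rightarrow> (real \<Rightarrow> real) \<Rightarrow> (real \<Rightarrow> real) \<Rightarrow> real \<Rightarrow> (real^'n) set \<Rightarrow> (real^'n \<Rightarrow> real) \<Rightarrow> bool" where
  "weak_solution p v w lam S u \<longleftrightarrow> in_D0 p v S u \<and>
     (\<forall>\<phi>. Cc1 S \<phi> \<longrightarrow>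
        set_lebesgue_integral lebesgue S
          (\<lambda>x. v (norm x) * norm (grad u x) powr (p - 2) * (grad u x \<bullet> grad \<phi> x))
        = lam * set_lebesgue_integral lebesgue S
          (\<lambda>x. w (norm x) * \<bar>u x\<bar> powr (p - 2) * u x * \<phi> x))"

definition cond_W :: "real \<Rightarrow> real \<Rightarrow> ereal \<Rightarrow> (real \<Rightarrow> real) \<Rightarrow> (real \<Rightarrow> real) \<Rightarrow> bool" where
  "cond_W p R1 R2 v w \<longleftrightarrow>
     (AE r in lebesgue. r \<in> ivl R1 R2 \<longrightarrow> v r > 0) \<and>
     (AE r in lebesgue. r \<in> ivl R1 R2 \<longrightarrow> w r > 0) \<and>
     continuous_on (ivl R1 R2) v \<and>
     set_borel_measurable lebesgue (ivl R1 R2) w \<and>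
     (\<forall>a b. {a..b} \<subseteq> ivl R1 R2 \<longrightarrow> set_integrable lebesgue {a..b} (\<lambda>r. v r powr (-1 / (p - 1)))) \<and>
     (\<forall>a b. {a..b} \<subseteq> ivl R1 R2 \<longrightarrow> set_integrable lebesgue {a..b} w)"

definition rho :: "nat \<Rightarrow> (real \<Rightarrow> real) \<Rightarrow> real \<Rightarrow> real" where
  "rho N v r = r ^ (N - 1) * v r"

definition sigma :: "nat \<Rightarrow> (real \<Rightarrow> real) \<Rightarrow> real \<Rightarrow> real" where
  "sigma N w r = r ^ (N - 1) * w r"

definition cond_A :: "nat \<Rightarrow> real \<Rightarrow> real \<Rightarrow> ereal \<Rightarrow> (real \<Rightarrow> real) \<Rightarrow> (real \<Rightarrow> real) \<Rightarrow> bool" where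
  "cond_A N p R1 R2 v w \<longleftrightarrow>
     (\<exists>\<xi>. R1 < \<xi> \<and> ereal \<xi> < R2 \<and>
        set_integrable lebesgue (ivl \<xi> R2) (\<lambda>\<tau>. rho N v \<tau> powr (1 - p / (p - 1))) \<and>
        (\<exists>\<epsilon> C. 0 < \<epsilon> \<and> \<epsilon> < p - 1 \<and> C > 0 \<and>
           (\<forall>r \<in> ivl \<xi> R2.
              (set_lebesgue_integral lebesgue {\<xi>..r} (sigma N w)) *
              (set_lebesgue_integral lebesgue (ivl r R2) (\<lambda>\<tau>. rho N v \<tau> powr (1 - p / (p - 1)))) powr \<epsilon>
              < C)))"

end

theory Submission
  imports Defs
begin

text \<open>
  Radial test functions and polar coordinates turn the equation into the first order system
  \<open>F' = - \<lambda> \<sigma> |U|^(p-2) U\<close>, \<open>|U'| = |F|^(1/(p-1)) h\<close> for the profile \<open>U\<close> and the flux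
  \<open>F = \<rho> |U'|^(p-2) U'\<close>, where \<open>h = \<rho>^(1-p')\<close>. Let \<open>H(r)\<close> be the integral of \<open>h\<close> over \<open>(r, R2)\<close>.
  The growth condition gives \<open>\<sigma> H^(p-1) \<in> L^1\<close> near \<open>R2\<close>, so for \<open>a\<close> close to \<open>R2\<close> the system is a
  contraction for the weighted norm \<open>sup |U| / H\<close> on \<open>(a, R2)\<close>, and \<open>U \<rightarrow> 0\<close> forces
  \<open>|U| \<le> c |F(a)|^(1/(p-1)) H\<close>. Inserting this in the first equation yields
  \<open>|F - F(a)| \<le> |F(a)|/2\<close> on \<open>(a, R2)\<close>. If \<open>F(a) = 0\<close>, then \<open>U\<close> vanishes near \<open>R2\<close> and hence,
  by local uniqueness, everywhere; otherwise \<open>F\<close> is bounded and bounded away from \<open>0\<close>, and both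
  two-sided estimates follow by integrating \<open>U'\<close>.
\<close>

section \<open>Integration tools\<close>

text \<open>The weight \<open>v\<close> may vanish on a null set and \<open>w\<close> is merely
  locally integrable. So the flux is only an indefinite integral, and
  \<open>|U'| = |F|^(1/(p-1)) h\<close> is available only where \<open>\<rho> > 0\<close>. The
  system is therefore used as a pair of integral inequalities between absolute values, homogeneous
  of degrees \<open>1/(p-1)\<close> and \<open>p-1\<close>. The product of these degrees is 1; this
  replaces the Lipschitz condition, which fails at zero for \<open>p \<noteq> 2\<close>, in both the
  uniqueness and the contraction argument.

  The obstacle to the contraction is that \<open>sup |U| / H\<close> is not known to be finite:
  \<open>U \<rightarrow> 0\<close> gives no rate. A weight \<open>H + \<eta>\<close> makes it
  finite, at the price of a flux term that grows like \<open>S\<close>, the integral of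
  \<open>\<sigma>\<close> from \<open>\<xi>\<close>, which may be unbounded. The growth condition
  gives \<open>S \<le> C H^(-\<epsilon>)\<close>, and \<open>H^(-\<epsilon>/(p-1)) h\<close> is
  integrable because \<open>\<epsilon> < p-1\<close>. This is a second use of that condition, beside
  the integrability of \<open>\<sigma> H^(p-1)\<close>.

  Once the flux is bounded away from 0 near \<open>R2\<close>, \<open>v\<close> cannot vanish there,
  so the bounds on \<open>U'\<close> hold at every point and not just a.e.\<close>

lemma absolutely_integrable_continuous_mult:
  fixes f g :: "real \<Rightarrow> real"
  assumes "continuous_on {a..b} f" "g absolutely_integrable_on {a..b}"
  shows "(\<lambda>x. f x * g x) absolutely_integrable_on {a..b}"
proof (rule absolutely_integrable_bounded_measurable_product_real)
  show "f \<in> borel_measurable (lebesgue_on {a..b})"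
    using assms(1) by (intro continuous_imp_measurable_on_sets_lebesgue) auto
  show "bounded (f ` {a..b})"
    using assms(1) by (intro compact_imp_bounded compact_continuous_image) auto
qed (use assms in auto)

text \<open>\<open>G\<close> is only absolutely continuous: below its density \<open>\<rho>^(1-p')\<close> may be discontinuous on an
  uncountable null set, the zero set of \<open>v\<close>.\<close>

lemma integral_chain_rule:
  fixes g G \<Phi> \<phi> :: "real \<Rightarrow> real"
  assumes ab: "a \<le> b" and g: "g integrable_on {a..b}" "\<And>x. x \<in> {a..b} \<Longrightarrow> 0 \<le> g x"
    and G: "\<And>x. x \<in> {a..b} \<Longrightarrow> G x = G a + integral {a..x} g"
    and \<Phi>: "\<And>y. y \<in> G ` {a..b} \<Longrightarrow> (\<Phi> has_real_derivative \<phi> y) (at y)"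
    and \<phi>: "continuous_on (G ` {a..b}) \<phi>"
  shows "(\<lambda>x. \<phi> (G x) * g x) integrable_on {a..b}"
    and "integral {a..b} (\<lambda>x. \<phi> (G x) * g x) = \<Phi> (G b) - \<Phi> (G a)"
proof -
  have contG: "continuous_on {a..b} G"
  proof -
    have "continuous_on {a..b} (\<lambda>x. G a + integral {a..x} g)"
      by (intro continuous_intros indefinite_integral_continuous_1 g)
    then show ?thesis by (rule continuous_on_eq) (rule G[symmetric])
  qed
  have cont: "continuous_on {a..b} (\<lambda>x. \<phi> (G x))"
    using continuous_on_compose2[OF \<phi> contG] by auto
  have gabs: "g absolutely_integrable_on {a..b}"
    using g by (intro nonnegative_absolutely_integrable_1) auto
  show int: "(\<lambda>x. \<phi> (G x) * g x) integrable_on {a..b}"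
    using absolutely_integrable_continuous_mult[OF cont gabs] absolutely_integrable_on_def by blast
  define D where "D x = \<Phi> (G x) - integral {a..x} (\<lambda>x. \<phi> (G x) * g x)" for x
  have Gdiff: "G t - G s = integral {s..t} g" "0 \<le> integral {s..t} g" if "a \<le> s" "s \<le> t" "t \<le> b" for s t
  proof -
    have "g integrable_on {a..t}" using g(1) by (rule integrable_on_subinterval) (use that in auto)
    from Henstock_Kurzweil_Integration.integral_combine[OF that(1,2) this]
    show "G t - G s = integral {s..t} g" using G[of s] G[of t] that by auto
    show "0 \<le> integral {s..t} g" using g(2) that by (intro Henstock_Kurzweil_Integration.integral_nonneg integrable_on_subinterval[OF g(1)]) auto
  qed
  \<comment> \<open>\<open>D\<close> need not be differentiable everywhere, so no derivative of
    \<open>D\<close> is taken. A bound by \<open>e * (G t - G s)\<close> adds up over adjacent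
    intervals, so bisection reduces it to short intervals around a point.\<close>
  have est: "\<bar>D b - D a\<bar> \<le> e * (G b - G a)" if e: "0 < e" for e
  proof -
    have "a \<le> a \<and> b \<le> b \<longrightarrow> \<bar>D b - D a\<bar> \<le> e * (G b - G a)"
      using ab
    proof (induction rule: Bolzano[where P = "\<lambda>s t. a \<le> s \<and> t \<le> b \<longrightarrow> \<bar>D t - D s\<bar> \<le> e * (G t - G s)"])
      case (trans x y z)
      then show ?case by (auto simp: algebra_simps)
    next
      case (local x)
      from continuous_on_iff[THEN iffD1, OF cont, rule_format, of x "e/2"] local e
      obtain d where d: "d > 0" "\<And>y. y \<in> {a..b} \<Longrightarrow> dist y x < d \<Longrightarrow> dist (\<phi> (G y)) (\<phi> (G x)) < e/2"
        by auto
      show ?case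
      proof (intro exI conjI allI impI)
        fix s t assume st: "s \<le> x \<and> x \<le> t \<and> t - s < d" "a \<le> s \<and> t \<le> b"
        have stle: "s \<le> t" using st by auto
        have near: "\<bar>\<phi> (G y) - \<phi> (G x)\<bar> < e/2" if "y \<in> {s..t}" for y
          using d(2)[of y] that st by (auto simp: dist_real_def)
        have Gle: "G s \<le> G t" using Gdiff[of s t] st by auto
        have contst: "continuous_on {s..t} G" using contG by (rule continuous_on_subset) (use st in auto)
        \<comment> \<open>The mean value theorem for \<open>\<Phi>\<close> gives a value strictly
          between \<open>G s\<close> and \<open>G t\<close>; the intermediate value theorem for
          \<open>G\<close> writes it as \<open>G c\<close> with \<open>c\<close> in the short
          interval, where \<open>\<phi> (G c)\<close> is close to \<open>\<phi> (G x)\<close>. If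
          \<open>G s = G t\<close>, both sides vanish and any \<open>c\<close> will do.\<close>
        obtain c where c: "c \<in> {s..t}" "\<Phi> (G t) - \<Phi> (G s) = \<phi> (G c) * (G t - G s)"
        proof (cases "G s = G t")
          case True
          then show ?thesis using that[of s] stle by auto
        next
          case False
          then have lt: "G s < G t" using Gle by auto
          have sub: "y \<in> G ` {s..t}" if y: "G s \<le> y" "y \<le> G t" for y
          proof -
            obtain c where "s \<le> c" "c \<le> t" "G c = y" using IVT'[OF y stle contst] by auto
            then show ?thesis by auto
          qed
          have "\<exists>z. G s < z \<and> z < G t \<and> \<Phi> (G t) - \<Phi> (G s) = (G t - G s) * \<phi> z"
            using lt by (rule MVT2) (use sub \<Phi> st in fastforce)
          then obtain z where z: "G s < z" "z < G t" "\<Phi> (G t) - \<Phi> (G s) = (G t - G s) * \<phi> z" by blast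
          with sub[of z] obtain c where "c \<in> {s..t}" "z = G c" by auto
          then show ?thesis using that z by (auto simp: mult.commute)
        qed
        have i1: "(\<lambda>x. \<phi> (G x) * g x) integrable_on {a..t}" using int by (rule integrable_on_subinterval) (use st in auto)
        have i2: "(\<lambda>x. \<phi> (G x) * g x) integrable_on {s..t}" using int by (rule integrable_on_subinterval) (use st in auto)
        have g2: "g integrable_on {s..t}" using g(1) by (rule integrable_on_subinterval) (use st in auto)
        have cg: "(\<lambda>x. \<phi> (G c) * g x) integrable_on {s..t}" using g2 by (rule integrable_on_mult_right)
        have "D t - D s = \<phi> (G c) * (G t - G s) - integral {s..t} (\<lambda>x. \<phi> (G x) * g x)"
          using Henstock_Kurzweil_Integration.integral_combine[OF _ stle i1] c(2) st by (auto simp: D_def)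
        also have "\<dots> = integral {s..t} (\<lambda>x. (\<phi> (G c) - \<phi> (G x)) * g x)"
          unfolding left_diff_distrib Henstock_Kurzweil_Integration.integral_diff[OF cg i2]
          using Gdiff[of s t] st by simp
        finally have Deq: "D t - D s = integral {s..t} (\<lambda>x. (\<phi> (G c) - \<phi> (G x)) * g x)" .
        have "norm (integral {s..t} (\<lambda>x. (\<phi> (G c) - \<phi> (G x)) * g x)) \<le> integral {s..t} (\<lambda>x. e * g x)"
        proof (rule Henstock_Kurzweil_Integration.integral_norm_bound_integral)
          show "(\<lambda>x. (\<phi> (G c) - \<phi> (G x)) * g x) integrable_on {s..t}"
            unfolding left_diff_distrib using cg i2 by (rule integrable_diff)
          show "(\<lambda>x. e * g x) integrable_on {s..t}" using g2 by (rule integrable_on_mult_right)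
          fix y assume y: "y \<in> {s..t}"
          have "\<bar>\<phi> (G c) - \<phi> (G y)\<bar> \<le> e" using near[OF c(1)] near[OF y] by linarith
          then show "norm ((\<phi> (G c) - \<phi> (G y)) * g y) \<le> e * g y"
            using g(2)[of y] y st by (auto simp: abs_mult intro!: mult_right_mono)
        qed
        then show "\<bar>D t - D s\<bar> \<le> e * (G t - G s)" using Deq Gdiff[of s t] st by auto
      qed (use d in auto)
    qed
    then show ?thesis by simp
  qed
  have "\<bar>D b - D a\<bar> \<le> 0"
  proof (rule field_le_epsilon)
    fix e :: real assume e: "0 < e"
    have G0: "0 \<le> G b - G a" using Gdiff[of a b] ab by auto
    have "\<bar>D b - D a\<bar> \<le> e / (G b - G a + 1) * (G b - G a)" using est[of "e / (G b - G a + 1)"] e G0 by auto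
    also have "\<dots> \<le> e" using e G0 by (auto simp: field_simps)
    finally show "\<bar>D b - D a\<bar> \<le> 0 + e" by simp
  qed
  then show "integral {a..b} (\<lambda>x. \<phi> (G x) * g x) = \<Phi> (G b) - \<Phi> (G a)" by (simp add: D_def)
qed

section \<open>Polar coordinates for radial functions\<close>

text \<open>The surface measure of the unit sphere, as the derivative of the volume of a ball at
  radius 1. It multiplies both sides of the weak equation and cancels there.\<close>

definition sphere_area :: "'a::euclidean_space itself \<Rightarrow> real" where
  "sphere_area _ = real DIM('a) * unit_ball_vol (real DIM('a))"

lemma sphere_area_pos: "0 < sphere_area TYPE('a::euclidean_space)"
  by (simp add: sphere_area_def)

text \<open>The half lines \<open>{..r}\<close> generate the Borel sets and are stable under
  intersection, so it suffices to compare two measures that are finite on them. One side is the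
  volume of a ball of radius \<open>r\<close>, the other the integral of the derivative of that
  volume.\<close>

lemma distr_norm_lborel:
  "distr (lborel :: 'a::euclidean_space measure) borel norm =
   density lborel (\<lambda>r. ennreal (indicator {0..} r * (sphere_area TYPE('a) * r ^ (DIM('a) - 1))))"
  (is "?M = ?N")
proof (rule measure_eqI_generator_eq)
  let ?E = "range (\<lambda>a::real. {..a})"
  have N: "Suc (DIM('a) - 1) = DIM('a)" by simp
  show "Int_stable ?E" by (auto simp: Int_stable_def)
  show "?E \<subseteq> Pow UNIV" by simp
  show "sets ?M = sigma_sets UNIV ?E" by (simp add: borel_eq_atMost)
  show "sets ?N = sigma_sets UNIV ?E" by (simp add: borel_eq_atMost)
  show "range (\<lambda>n. {..real n}) \<subseteq> ?E" by auto
  show "(\<Union>i. {..real i}) = UNIV" using real_arch_simple by auto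
  have M1: "emeasure ?M {..r} = ennreal (unit_ball_vol (real DIM('a)) * r ^ DIM('a))" if "0 \<le> r" for r
  proof -
    have "emeasure ?M {..r} = emeasure lborel (cball (0::'a) r)"
      by (subst emeasure_distr) (auto intro!: arg_cong[where f = "emeasure lborel"] simp: dist_norm)
    then show ?thesis using that by (simp add: emeasure_cball)
  qed
  then show "emeasure ?M {..real i} \<noteq> \<infinity>" for i by simp
  fix X assume "X \<in> ?E"
  then obtain r where X: "X = {..r}" by auto
  show "emeasure ?M X = emeasure ?N X"
  proof (cases "0 \<le> r")
    case True
    have "emeasure ?N X = (\<integral>\<^sup>+ x. ennreal (sphere_area TYPE('a) * x ^ (DIM('a) - 1)) * indicator {0..r} x \<partial>lborel)"
      unfolding X by (subst emeasure_density) (auto intro!: nn_integral_cong simp: indicator_def)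
    also have "\<dots> = ennreal (unit_ball_vol (real DIM('a)) * r ^ DIM('a) - unit_ball_vol (real DIM('a)) * 0 ^ DIM('a))"
      using True sphere_area_pos[where 'a='a]
      by (intro nn_integral_FTC_Icc) (auto intro!: derivative_eq_intros simp: sphere_area_def)
    finally show ?thesis using M1[OF True] X by (simp add: zero_power)
  next
    case False
    have z: "ennreal (indicator {0..} x * (sphere_area TYPE('a) * x ^ (DIM('a) - 1))) * indicator {..r} x = 0" for x
      using False by (auto simp: indicator_def)
    have "\<not> norm x \<le> r" for x :: 'a using norm_ge_zero[of x] False by linarith
    then have "norm -` {..r} = ({} :: 'a set)" by auto
    then have "emeasure ?M X = 0" unfolding X by (subst emeasure_distr) auto
    moreover have "emeasure ?N X = 0"
      unfolding X by (subst emeasure_density; (simp only: z)?; simp)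
    ultimately show ?thesis by simp
  qed
qed

text \<open>The image of Lebesgue measure under the norm has a density, so a null set of radii pulls
  back to a null set of points.\<close>

lemma AE_norm_lebesgue:
  assumes "AE r in lebesgue. P r"
  shows "AE x :: 'a::euclidean_space in lebesgue. P (norm x)"
proof -
  have "AE r in lborel. P r" using assms by (simp add: AE_completion_iff)
  then have "AE r in distr (lborel :: 'a measure) borel norm. P r"
    unfolding distr_norm_lborel by (subst AE_density) auto
  then have "AE x :: 'a in lborel. P (norm x)" by (rule AE_distrD[rotated]) simp
  then show ?thesis by (simp add: AE_completion_iff)
qed

text \<open>A Lebesgue measurable function need not stay measurable under composition, so
  \<open>f\<close> is replaced by a Borel function equal to it a.e. Integrability is not assumed:
  the image measure and density formulas also hold when both integrals default to 0. Since the
  integral on the right runs over the whole line, \<open>f\<close> has to vanish at negative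
  radii.\<close>

lemma integral_norm_lebesgue:
  fixes f :: "real \<Rightarrow> real"
  assumes f: "f \<in> borel_measurable lebesgue" and f0: "\<And>r. r < 0 \<Longrightarrow> f r = 0"
  shows "integral\<^sup>L lebesgue (\<lambda>x::'a::euclidean_space. f (norm x)) =
     sphere_area TYPE('a) * integral\<^sup>L lebesgue (\<lambda>r. r ^ (DIM('a) - 1) * f r)"
proof -
  obtain g where g[measurable]: "g \<in> borel_measurable lborel" and fg: "AE r in lborel. f r = g r"
    using completion_ex_borel_measurable_real[OF f] by blast
  have fg': "AE r in lebesgue. f r = g r" using fg by (rule AE_completion)
  have AE1: "AE x::'a in lebesgue. g (norm x) = f (norm x)" using AE_norm_lebesgue[OF fg'] by auto
  have gn: "(\<lambda>x::'a. g (norm x)) \<in> borel_measurable lebesgue" by (rule measurable_completion) simp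
  have fn: "(\<lambda>x::'a. f (norm x)) \<in> borel_measurable lebesgue"
    using gn AE1 by (rule borel_measurable_AE)
  have "integral\<^sup>L lebesgue (\<lambda>x::'a. f (norm x)) = integral\<^sup>L lebesgue (\<lambda>x::'a. g (norm x))"
    using AE1 by (intro integral_cong_AE gn fn) auto
  also have "\<dots> = integral\<^sup>L lborel (\<lambda>x::'a. g (norm x))" by (rule integral_completion) simp
  also have "\<dots> = integral\<^sup>L (distr (lborel :: 'a measure) borel norm) g" by (rule integral_distr[symmetric]) auto
  also have "\<dots> = integral\<^sup>L lborel (\<lambda>r. (indicator {0..} r * (sphere_area TYPE('a) * r ^ (DIM('a) - 1))) *\<^sub>R g r)"
    unfolding distr_norm_lborel using sphere_area_pos[where 'a='a]
    by (intro integral_density) (auto simp: indicator_def)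
  also have "\<dots> = integral\<^sup>L lebesgue (\<lambda>r. (indicator {0..} r * (sphere_area TYPE('a) * r ^ (DIM('a) - 1))) *\<^sub>R g r)"
    by (rule integral_completion[symmetric]) simp
  also have "\<dots> = integral\<^sup>L lebesgue (\<lambda>r. sphere_area TYPE('a) * (r ^ (DIM('a) - 1) * f r))"
  proof (rule integral_cong_AE)
    show "(\<lambda>r. (indicator {0..} r * (sphere_area TYPE('a) * r ^ (DIM('a) - 1))) *\<^sub>R g r) \<in> borel_measurable lebesgue"
      by (rule measurable_completion) simp
    have "(\<lambda>r::real. r ^ (DIM('a) - 1)) \<in> borel_measurable lebesgue" by (rule measurable_completion) simp
    then show "(\<lambda>r. sphere_area TYPE('a) * (r ^ (DIM('a) - 1) * f r)) \<in> borel_measurable lebesgue"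
      using f by measurable
    show "AE r in lebesgue. (indicator {0..} r * (sphere_area TYPE('a) * r ^ (DIM('a) - 1))) *\<^sub>R g r
        = sphere_area TYPE('a) * (r ^ (DIM('a) - 1) * f r)"
      using fg' by eventually_elim (use f0 in \<open>auto simp: indicator_def not_le\<close>)
  qed
  finally show ?thesis by simp
qed

section \<open>From the weak to the integrated equation\<close>

lemma DERIV_pos_part_square:
  "((\<lambda>x::real. (max 0 x)\<^sup>2) has_real_derivative 2 * max 0 x) (at x)"
proof -
  consider "x < 0" | "x = 0" | "0 < x" by linarith
  then show ?thesis
  proof cases
    case 1
    have "((\<lambda>_. 0) has_real_derivative 2 * max 0 x) (at x)" using 1 by simp
    then show ?thesis by (rule has_field_derivative_transform_within_open[of _ _ _ "{..<0}"]) (use 1 in auto)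
  next
    case 2
    have "((\<lambda>h. (max 0 h)\<^sup>2 / h) \<longlongrightarrow> 0) (at (0::real))"
    proof (rule Lim_null_comparison)
      show "\<forall>\<^sub>F h in at (0::real). norm ((max 0 h)\<^sup>2 / h) \<le> \<bar>h\<bar>"
        by (rule always_eventually) (auto simp: max_def power2_eq_square)
      show "((\<lambda>h::real. \<bar>h\<bar>) \<longlongrightarrow> 0) (at 0)" by (rule tendsto_eq_intros refl | simp)+
    qed
    then show ?thesis using 2 by (simp add: DERIV_def)
  next
    case 3
    have "((\<lambda>x. x\<^sup>2) has_real_derivative 2 * max 0 x) (at x)" using 3 by (auto intro!: derivative_eq_intros)
    then show ?thesis by (rule has_field_derivative_transform_within_open[of _ _ _ "{0<..}"]) (use 3 in auto)
  qed
qed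

text \<open>On \<open>[0, 1/2]\<close> this is \<open>2 x^2\<close>, on \<open>[1/2, 1]\<close> it
  is \<open>1 - 2 (1 - x)^2\<close>. A linear ramp would not do, since test functions must be
  \<open>C^1\<close>; squared positive parts avoid case distinctions in the derivative, which is a
  tent of height 2 and mass 1.\<close>

definition smooth_step :: "real \<Rightarrow> real" where
  "smooth_step x = 2 * (max 0 x)\<^sup>2 - 4 * (max 0 (x - 1/2))\<^sup>2 + 2 * (max 0 (x - 1))\<^sup>2"

definition tent :: "real \<Rightarrow> real" where
  "tent x = 4 * max 0 x - 8 * max 0 (x - 1/2) + 4 * max 0 (x - 1)"

lemma DERIV_smooth_step: "(smooth_step has_real_derivative tent x) (at x)"
proof -
  have *: "((\<lambda>x::real. (max 0 (x - a))\<^sup>2) has_real_derivative 2 * max 0 (x - a)) (at x)" for a x :: real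
  proof -
    have "((\<lambda>x. x - a) has_real_derivative 1) (at x)" by (auto intro!: derivative_eq_intros)
    from DERIV_chain2[OF DERIV_pos_part_square this] show ?thesis by simp
  qed
  have "((\<lambda>x. 2 * (max 0 x)\<^sup>2 - 4 * (max 0 (x - 1/2))\<^sup>2 + 2 * (max 0 (x - 1))\<^sup>2) has_real_derivative
      2 * (2 * max 0 x) - 4 * (2 * max 0 (x - 1/2)) + 2 * (2 * max 0 (x - 1))) (at x)"
    by (intro DERIV_add DERIV_diff DERIV_cmult DERIV_pos_part_square *)
  then show ?thesis unfolding smooth_step_def[abs_def] tent_def by simp
qed

lemma continuous_tent: "continuous_on A tent"
  unfolding tent_def by (intro continuous_intros)

lemma tent_nonneg: "0 \<le> tent x" and tent_outside: "x \<le> 0 \<or> 1 \<le> x \<Longrightarrow> tent x = 0"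
  by (auto simp: tent_def max_def)

lemma smooth_step_left: "x \<le> 0 \<Longrightarrow> smooth_step x = 0"
  by (auto simp: smooth_step_def max_def)

lemma smooth_step_right: "1 \<le> x \<Longrightarrow> smooth_step x = 1"
  by (auto simp: smooth_step_def max_def power2_eq_square algebra_simps)

lemma smooth_step_bounds: "0 \<le> smooth_step x" "smooth_step x \<le> 1"
proof -
  have mono: "smooth_step a \<le> smooth_step b" if "a \<le> b" for a b
    using that DERIV_smooth_step tent_nonneg by (intro DERIV_nonneg_imp_nondecreasing[of a b smooth_step]) blast+
  show "0 \<le> smooth_step x" using mono[of "min 0 x" x] smooth_step_left[of "min 0 x"] by simp
  show "smooth_step x \<le> 1" using mono[of x "max 1 x"] smooth_step_right[of "max 1 x"] by simp
qed

text \<open>The kernels have mass one and sit where \<open>F\<close> differs from \<open>F x\<close>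
  by at most \<open>e/2\<close>. The mass is one only eventually, because the kernels must be narrow
  enough to fit into \<open>{c..d}\<close>.\<close>

lemma approximate_identity:
  fixes F :: "real \<Rightarrow> real" and k :: "nat \<Rightarrow> real \<Rightarrow> real"
  assumes F: "continuous_on {c..d} F" and x: "x \<in> {c..d}"
    and k: "\<And>n. continuous_on {c..d} (k n)" "\<And>n r. 0 \<le> k n r"
      "\<forall>\<^sub>F n in sequentially. integral {c..d} (k n) = 1"
      "\<And>n r. 1 / real (Suc n) < \<bar>r - x\<bar> \<Longrightarrow> k n r = 0"
  shows "(\<lambda>n. integral {c..d} (\<lambda>r. F r * k n r)) \<longlonglongrightarrow> F x"
proof (rule tendstoI)
  fix e :: real assume e: "0 < e"
  obtain \<delta> where \<delta>: "\<delta> > 0" "\<And>y. y \<in> {c..d} \<Longrightarrow> dist y x < \<delta> \<Longrightarrow> dist (F y) (F x) < e/2"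
    using F[unfolded continuous_on_iff, rule_format, of x "e/2"] x e by auto
  have "\<forall>\<^sub>F n in sequentially. 1 / real (Suc n) < \<delta>"
    using order_tendstoD(2)[OF LIMSEQ_inverse_real_of_nat \<delta>(1)] by (simp add: inverse_eq_divide)
  then show "\<forall>\<^sub>F n in sequentially. dist (integral {c..d} (\<lambda>r. F r * k n r)) (F x) < e"
    using k(3)
  proof eventually_elim
    case (elim n)
    have i1: "(\<lambda>r. F r * k n r) integrable_on {c..d}" by (intro integrable_continuous_real continuous_intros F k)
    have i2: "(\<lambda>r. F x * k n r) integrable_on {c..d}" by (intro integrable_continuous_real continuous_intros k)
    have i3: "(\<lambda>r. e/2 * k n r) integrable_on {c..d}" by (intro integrable_continuous_real continuous_intros k)
    have "integral {c..d} (\<lambda>r. F r * k n r) - F x = integral {c..d} (\<lambda>r. F r * k n r) - integral {c..d} (\<lambda>r. F x * k n r)"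
      using elim by simp
    also have "\<dots> = integral {c..d} (\<lambda>r. F r * k n r - F x * k n r)"
      using Henstock_Kurzweil_Integration.integral_diff[OF i1 i2] by simp
    finally have eq: "integral {c..d} (\<lambda>r. F r * k n r) - F x = integral {c..d} (\<lambda>r. F r * k n r - F x * k n r)" .
    have "norm (integral {c..d} (\<lambda>r. F r * k n r - F x * k n r)) \<le> integral {c..d} (\<lambda>r. e/2 * k n r)"
    proof (rule Henstock_Kurzweil_Integration.integral_norm_bound_integral[OF integrable_diff[OF i1 i2] i3])
      fix r assume r: "r \<in> {c..d}"
      show "norm (F r * k n r - F x * k n r) \<le> e/2 * k n r"
      proof (cases "k n r = 0")
        case False
        then have "\<bar>r - x\<bar> \<le> 1 / real (Suc n)" using k(4)[of n r] by force
        then have "\<bar>F r - F x\<bar> \<le> e/2" using \<delta>(2)[OF r] elim by (auto simp: dist_real_def)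
        then have "\<bar>F r - F x\<bar> * k n r \<le> e/2 * k n r" using k(2) by (intro mult_right_mono) auto
        moreover have "norm (F r * k n r - F x * k n r) = \<bar>F r - F x\<bar> * k n r"
          using k(2)[of n r] by (simp add: abs_mult flip: left_diff_distrib)
        ultimately show ?thesis by simp
      qed simp
    qed
    also have "\<dots> = e/2" using elim by simp
    finally show ?case using eq e by (simp add: dist_real_def)
  qed
qed

text \<open>The test functions are plateaus that rise to 1 just before \<open>s\<close> and fall
  back just after \<open>t\<close>. Their derivatives concentrate at \<open>s\<close> and
  \<open>t\<close> with opposite signs and produce \<open>F s - F t\<close> by continuity of
  \<open>F\<close>, while the plateaus converge boundedly to the indicator of
  \<open>{s..t}\<close>.\<close>

lemma integrated_weak_equation:
  fixes F k :: "real \<Rightarrow> real"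
  assumes J: "open J" "is_interval J" and F: "continuous_on J F"
    and k: "\<And>a b. {a..b} \<subseteq> J \<Longrightarrow> k absolutely_integrable_on {a..b}"
    and weak: "\<And>\<psi> \<psi>' c d. {c..d} \<subseteq> J \<Longrightarrow> (\<And>r. (\<psi> has_real_derivative \<psi>' r) (at r)) \<Longrightarrow>
        continuous_on UNIV \<psi>' \<Longrightarrow> (\<And>r. r \<notin> {c<..<d} \<Longrightarrow> \<psi> r = 0 \<and> \<psi>' r = 0) \<Longrightarrow>
        (LINT r:J|lebesgue. F r * \<psi>' r) = (LINT r:J|lebesgue. k r * \<psi> r)"
    and st: "s \<le> t" "s \<in> J" "t \<in> J"
  shows "F t - F s = - integral {s..t} k"
proof -
  obtain e1 where e1: "e1 > 0" "{s-e1..s+e1} \<subseteq> J"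
    using J(1)[unfolded open_contains_cball] st(2) by (auto simp: cball_eq_atLeastAtMost)
  obtain e2 where e2: "e2 > 0" "{t-e2..t+e2} \<subseteq> J"
    using J(1)[unfolded open_contains_cball] st(3) by (auto simp: cball_eq_atLeastAtMost)
  define c d where "c = s - e1" and "d = t + e2"
  have cd: "c < s" "t < d" using e1 e2 by (auto simp: c_def d_def)
  have "c \<in> J" "d \<in> J" using e1 e2 by (auto simp: c_def d_def)
  then have sub: "{c..d} \<subseteq> J" using J(2) unfolding is_interval_1 by (meson atLeastAtMost_iff subsetI)
  \<comment> \<open>The kernel \<open>k1 n\<close> lives on the left of \<open>s\<close> and
    \<open>k2 n\<close> on the right of \<open>t\<close>, each within distance
    \<open>1 / Suc n\<close>. So the plateau equals 1 on all of \<open>{s..t}\<close>, also when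
    \<open>s = t\<close>.\<close>
  define k1 k2 where "k1 n r = tent (real (Suc n) * (r - s) + 1) * real (Suc n)"
    and "k2 n r = tent (real (Suc n) * (r - t)) * real (Suc n)" for n r
  define \<psi> where "\<psi> n r = smooth_step (real (Suc n) * (r - s) + 1) - smooth_step (real (Suc n) * (r - t))" for n r
  have d1: "((\<lambda>r. smooth_step (real (Suc n) * (r - s) + 1)) has_real_derivative k1 n r) (at r)" for n r
  proof -
    have "((\<lambda>r. real (Suc n) * (r - s) + 1) has_real_derivative real (Suc n)) (at r)"
      by (auto intro!: derivative_eq_intros)
    from DERIV_chain2[OF DERIV_smooth_step this] show ?thesis unfolding k1_def .
  qed
  have d2: "((\<lambda>r. smooth_step (real (Suc n) * (r - t))) has_real_derivative k2 n r) (at r)" for n r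
  proof -
    have "((\<lambda>r. real (Suc n) * (r - t)) has_real_derivative real (Suc n)) (at r)"
      by (auto intro!: derivative_eq_intros)
    from DERIV_chain2[OF DERIV_smooth_step this] show ?thesis unfolding k2_def .
  qed
  have d\<psi>: "(\<psi> n has_real_derivative k1 n r - k2 n r) (at r)" for n r
    unfolding \<psi>_def using DERIV_diff[OF d1 d2] by simp
  have cont: "continuous_on A (k1 n)" "continuous_on A (k2 n)" for A n
    unfolding k1_def k2_def
    by (intro continuous_intros continuous_on_compose2[OF continuous_tent[of UNIV]]; simp)+
  \<comment> \<open>For such \<open>n\<close> both transition layers lie inside
    \<open>(c, d)\<close>: the plateau is an admissible test function and neither kernel loses
    mass.\<close>
  have ev: "\<forall>\<^sub>F n in sequentially. 1 / real (Suc n) < min (s - c) (d - t)"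
    using order_tendstoD(2)[OF LIMSEQ_inverse_real_of_nat, of "min (s - c) (d - t)"] cd by (simp add: inverse_eq_divide)
  have out: "1 \<le> real (Suc n) * x \<longleftrightarrow> 1 / real (Suc n) \<le> x" for n x
    by (simp add: field_simps)
  have step1: "smooth_step (real (Suc n) * (r - s) + 1) = 0" "k1 n r = 0" if "r \<le> s - 1 / real (Suc n)" for n r
  proof -
    have "1 \<le> real (Suc n) * (s - r)" using that unfolding out by simp
    then have "real (Suc n) * (r - s) + 1 \<le> 0" by (simp add: algebra_simps)
    then show "smooth_step (real (Suc n) * (r - s) + 1) = 0" "k1 n r = 0"
      by (auto simp: smooth_step_left tent_outside k1_def)
  qed
  have step2: "smooth_step (real (Suc n) * (r - s) + 1) = 1" "k1 n r = 0" if "s \<le> r" for n r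
  proof -
    have "1 \<le> real (Suc n) * (r - s) + 1" using that by simp
    then show "smooth_step (real (Suc n) * (r - s) + 1) = 1" "k1 n r = 0"
      by (auto simp: smooth_step_right tent_outside k1_def)
  qed
  have step3: "smooth_step (real (Suc n) * (r - t)) = 0" "k2 n r = 0" if "r \<le> t" for n r
  proof -
    have "real (Suc n) * (r - t) \<le> 0" using that by (intro mult_nonneg_nonpos) auto
    then show "smooth_step (real (Suc n) * (r - t)) = 0" "k2 n r = 0"
      by (auto simp: smooth_step_left tent_outside k2_def)
  qed
  have step4: "smooth_step (real (Suc n) * (r - t)) = 1" "k2 n r = 0" if "t + 1 / real (Suc n) \<le> r" for n r
  proof -
    have "1 \<le> real (Suc n) * (r - t)" using that unfolding out by simp
    then show "smooth_step (real (Suc n) * (r - t)) = 1" "k2 n r = 0"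
      by (auto simp: smooth_step_right tent_outside k2_def)
  qed
  have supp: "\<psi> n r = 0 \<and> k1 n r - k2 n r = 0" if n: "1 / real (Suc n) < min (s - c) (d - t)" and r: "r \<notin> {c<..<d}" for n r
  proof (cases "r \<le> c")
    case True
    then have "r \<le> s - 1 / real (Suc n)" "r \<le> t" using n st cd by auto
    then show ?thesis using step1[of r n] step3[of r n] by (simp add: \<psi>_def)
  next
    case False
    then have "t + 1 / real (Suc n) \<le> r" "s \<le> r" using n st cd r by auto
    then show ?thesis using step2[of r n] step4[of n r] by (simp add: \<psi>_def)
  qed
  have Fcd: "continuous_on {c..d} F" using F sub by (rule continuous_on_subset)
  have int1: "\<forall>\<^sub>F n in sequentially. integral {c..d} (k1 n) = 1"
    using ev
  proof eventually_elim
    case (elim n)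
    have "(k1 n has_integral (smooth_step (real (Suc n) * (d - s) + 1) - smooth_step (real (Suc n) * (c - s) + 1))) {c..d}"
      using cd st d1 by (intro fundamental_theorem_of_calculus) (auto simp flip: has_real_derivative_iff_has_vector_derivative intro: has_field_derivative_at_within)
    then show ?case using step1[of c n] step2[of d n] elim cd st by (simp add: integral_unique)
  qed
  have int2: "\<forall>\<^sub>F n in sequentially. integral {c..d} (k2 n) = 1"
    using ev
  proof eventually_elim
    case (elim n)
    have "(k2 n has_integral (smooth_step (real (Suc n) * (d - t)) - smooth_step (real (Suc n) * (c - t)))) {c..d}"
      using cd st d2 by (intro fundamental_theorem_of_calculus) (auto simp flip: has_real_derivative_iff_has_vector_derivative intro: has_field_derivative_at_within)
    then show ?case using step3[of c n] step4[of n d] elim cd st by (simp add: integral_unique)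
  qed
  have "(\<lambda>n. integral {c..d} (\<lambda>r. F r * k1 n r)) \<longlonglongrightarrow> F s"
  proof (rule approximate_identity[OF Fcd _ cont(1) _ int1])
    show "0 \<le> k1 n r" for n r by (simp add: k1_def tent_nonneg)
    show "k1 n r = 0" if "1 / real (Suc n) < \<bar>r - s\<bar>" for n r
      using step1(2)[of r n] step2(2)[of r n] that by (cases "s \<le> r") auto
  qed (use cd st in auto)
  moreover have "(\<lambda>n. integral {c..d} (\<lambda>r. F r * k2 n r)) \<longlonglongrightarrow> F t"
  proof (rule approximate_identity[OF Fcd _ cont(2) _ int2])
    show "0 \<le> k2 n r" for n r by (simp add: k2_def tent_nonneg)
    show "k2 n r = 0" if "1 / real (Suc n) < \<bar>r - t\<bar>" for n r
      using step3(2)[of r n] step4(2)[of n r] that by (cases "t \<le> r") auto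
  qed (use cd st in auto)
  ultimately have lim1: "(\<lambda>n. integral {c..d} (\<lambda>r. F r * k1 n r) - integral {c..d} (\<lambda>r. F r * k2 n r)) \<longlonglongrightarrow> F s - F t"
    by (rule tendsto_diff)
  have kcd: "integrable lebesgue (\<lambda>r. indicator {c..d} r * k r)"
    using k[OF sub] by (simp add: set_integrable_def)
  have km: "(\<lambda>r. indicator {c..d} r * k r) \<in> borel_measurable lebesgue" using kcd by (rule borel_measurable_integrable)
  have m\<psi>: "\<psi> n \<in> borel_measurable lebesgue" for n
  proof (rule measurable_completion)
    have "continuous_on UNIV (\<psi> n)" using d\<psi> by (intro DERIV_continuous_on) auto
    then show "\<psi> n \<in> borel_measurable lborel" by (simp add: borel_measurable_continuous_onI)
  qed
  have lim2: "(\<lambda>n. LINT r|lebesgue. indicator {c..d} r * k r * \<psi> n r) \<longlonglongrightarrow> (LINT r|lebesgue. indicator {s..t} r * k r)"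
  proof (rule integral_dominated_convergence[where w = "\<lambda>r. \<bar>indicator {c..d} r * k r\<bar>"])
    show "(\<lambda>r. indicator {s..t} r * k r) \<in> borel_measurable lebesgue"
    proof -
      have "(\<lambda>r. indicator {s..t} r * (indicator {c..d} r * k r)) \<in> borel_measurable lebesgue"
        by (rule borel_measurable_times[OF borel_measurable_indicator km]) simp
      also have "(\<lambda>r. indicator {s..t} r * (indicator {c..d} r * k r)) = (\<lambda>r. indicator {s..t} r * k r)"
        using cd by (auto simp: indicator_def)
      finally show ?thesis .
    qed
    show "(\<lambda>r. indicator {c..d} r * k r * \<psi> n r) \<in> borel_measurable lebesgue" for n
      by (intro borel_measurable_times km m\<psi>)
    show "integrable lebesgue (\<lambda>r. \<bar>indicator {c..d} r * k r\<bar>)" using kcd by (rule integrable_abs)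
    have "\<bar>\<psi> n r\<bar> \<le> 1" for n r
      unfolding \<psi>_def using smooth_step_bounds[of "real (Suc n) * (r - s) + 1"] smooth_step_bounds[of "real (Suc n) * (r - t)"] by linarith
    then show "AE r in lebesgue. norm (indicator {c..d} r * k r * \<psi> n r) \<le> \<bar>indicator {c..d} r * k r\<bar>" for n
      by (intro always_eventually allI) (auto simp: abs_mult intro!: mult_left_le)
    show "AE r in lebesgue. (\<lambda>n. indicator {c..d} r * k r * \<psi> n r) \<longlonglongrightarrow> indicator {s..t} r * k r"
    proof (intro always_eventually allI)
      fix r
      have small: "\<forall>\<^sub>F n in sequentially. 1 / real (Suc n) < x" if "0 < x" for x
        using order_tendstoD(2)[OF LIMSEQ_inverse_real_of_nat that] by (simp add: inverse_eq_divide)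
      consider "r < s" | "s \<le> r" "r \<le> t" | "t < r" by linarith
      then have "\<forall>\<^sub>F n in sequentially. indicator {c..d} r * k r * \<psi> n r = indicator {s..t} r * k r"
      proof cases
        case 1
        have "\<forall>\<^sub>F n in sequentially. 1 / real (Suc n) < s - r" using 1 by (intro small) simp
        then show ?thesis
        proof eventually_elim
          case (elim n)
          then show ?case using step1[of r n] step3[of r n] 1 st by (simp add: \<psi>_def)
        qed
      next
        case 2
        then show ?thesis using step2[of r] step3[of r] cd by (simp add: \<psi>_def)
      next
        case 3
        have "\<forall>\<^sub>F n in sequentially. 1 / real (Suc n) < r - t" using 3 by (intro small) simp
        then show ?thesis
        proof eventually_elim
          case (elim n)
          then show ?case using step2[of r n] step4[of n r] 3 st by (simp add: \<psi>_def)
        qed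
      qed
      then show "(\<lambda>n. indicator {c..d} r * k r * \<psi> n r) \<longlonglongrightarrow> indicator {s..t} r * k r"
        by (rule tendsto_eventually)
    qed
  qed
  have "\<forall>\<^sub>F n in sequentially. (LINT r|lebesgue. indicator {c..d} r * k r * \<psi> n r)
      = integral {c..d} (\<lambda>r. F r * k1 n r) - integral {c..d} (\<lambda>r. F r * k2 n r)"
    using ev
  proof eventually_elim
    case (elim n)
    note supp' = supp[OF elim]
    have inJ: "r \<in> J" if "r \<in> {c<..<d}" for r
      using sub[THEN subsetD, of r] that by simp
    have i1: "(\<lambda>r. F r * k1 n r) integrable_on {c..d}" by (intro integrable_continuous_real continuous_intros Fcd cont)
    have i2: "(\<lambda>r. F r * k2 n r) integrable_on {c..d}" by (intro integrable_continuous_real continuous_intros Fcd cont)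
    have abs: "(\<lambda>r. F r * (k1 n r - k2 n r)) absolutely_integrable_on {c..d}"
      using Fcd by (intro absolutely_integrable_continuous_real continuous_intros cont)
    have "(LINT r|lebesgue. indicator {c..d} r * k r * \<psi> n r) = (LINT r:J|lebesgue. k r * \<psi> n r)"
      unfolding set_lebesgue_integral_def
    proof (rule Bochner_Integration.integral_cong)
      fix r show "indicator {c..d} r * k r * \<psi> n r = indicator J r *\<^sub>R (k r * \<psi> n r)"
        using supp'[of r] inJ[of r] by (cases "r \<in> {c<..<d}") (auto simp: indicator_def)
    qed simp
    also have "\<dots> = (LINT r:J|lebesgue. F r * (k1 n r - k2 n r))"
      by (rule weak[OF sub d\<psi> _ supp', symmetric]) (intro continuous_intros cont)
    also have "\<dots> = (LINT r:{c..d}|lebesgue. F r * (k1 n r - k2 n r))"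
      unfolding set_lebesgue_integral_def
    proof (rule Bochner_Integration.integral_cong)
      fix r show "indicator J r *\<^sub>R (F r * (k1 n r - k2 n r)) = indicator {c..d} r *\<^sub>R (F r * (k1 n r - k2 n r))"
        using supp'[of r] inJ[of r] by (cases "r \<in> {c<..<d}") (auto simp: indicator_def)
    qed simp
    also have "\<dots> = integral {c..d} (\<lambda>r. F r * (k1 n r - k2 n r))"
      using abs by (rule set_lebesgue_integral_eq_integral)
    also have "\<dots> = integral {c..d} (\<lambda>r. F r * k1 n r) - integral {c..d} (\<lambda>r. F r * k2 n r)"
      unfolding right_diff_distrib by (rule Henstock_Kurzweil_Integration.integral_diff[OF i1 i2])
    finally show ?case .
  qed
  then have "(\<lambda>n. LINT r|lebesgue. indicator {c..d} r * k r * \<psi> n r) \<longlonglongrightarrow> F s - F t"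
    using lim1 by (simp cong: filterlim_cong)
  then have "F s - F t = (LINT r|lebesgue. indicator {s..t} r * k r)" using lim2 by (rule LIMSEQ_unique)
  also have "\<dots> = (LINT r:{s..t}|lebesgue. k r)" by (simp add: set_lebesgue_integral_def)
  also have "\<dots> = integral {s..t} k" using sub cd by (intro set_lebesgue_integral_eq_integral k) auto
  finally show ?thesis by simp
qed

section \<open>Radial solutions\<close>

lemma open_ivl: "open (ivl a R2)"
proof -
  have "ivl a R2 = {a<..} \<inter> {r. ereal r < R2}" by (auto simp: ivl_def)
  moreover have "open {r. ereal r < R2}" by (intro open_Collect_less continuous_intros) 
  ultimately show ?thesis by (simp add: open_Int)
qed

lemma is_interval_ivl: "is_interval (ivl a R2)"
  unfolding is_interval_1 ivl_def by (auto intro: le_less_trans order.strict_trans2 simp: ereal_less_eq(3)[symmetric] simp del: ereal_less_eq(3))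

lemma annulus_vimage: "annulus R1 R2 = norm -` ivl R1 R2"
  by (auto simp: annulus_def ivl_def)

lemma open_annulus: "open (annulus R1 R2)"
  unfolding annulus_vimage by (intro open_vimage open_ivl continuous_intros)

lemma grad_radial:
  fixes f :: "real^'n \<Rightarrow> real"
  assumes "x \<noteq> 0" "open S" "x \<in> S" and eq: "\<And>y. y \<in> S \<Longrightarrow> f y = \<psi> (norm y)"
    and \<psi>: "(\<psi> has_real_derivative d) (at (norm x))"
  shows "f differentiable (at x)" "grad f x = d *\<^sub>R sgn x"
proof -
  have "((\<lambda>y. \<psi> (norm y)) has_derivative (\<lambda>h. d * (sgn x \<bullet> h))) (at x)"
    using has_derivative_compose[OF has_derivative_norm[OF assms(1)] \<psi>[unfolded has_field_derivative_def]]
    by (simp add: inner_commute)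
  then have *: "(f has_derivative (\<lambda>h. d * (sgn x \<bullet> h))) (at x)"
    by (rule has_derivative_transform_within_open[OF _ assms(2,3)]) (simp add: eq)
  then show "f differentiable (at x)" by (auto simp: differentiable_def)
  show "grad f x = d *\<^sub>R sgn x"
    unfolding grad_def frechet_derivative_at[OF *, symmetric] by (simp add: vec_eq_iff inner_axis)
qed

text \<open>On a fixed ray, \<open>U\<close> is the composition of \<open>u\<close> with a linear
  map, hence differentiable; its derivative is the component of the gradient along the ray, which
  carries over continuity.\<close>

lemma radial_profile:
  fixes u :: "real^'n \<Rightarrow> real"
  assumes R1: "0 < R1" and radial: "\<And>x. x \<in> annulus R1 R2 \<Longrightarrow> u x = U (norm x)"
    and C1: "C1_on (annulus R1 R2) u"
  shows "r \<in> ivl R1 R2 \<Longrightarrow> (U has_real_derivative deriv U r) (at r)"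
    and "continuous_on (ivl R1 R2) (deriv U)"
    and "x \<in> annulus R1 R2 \<Longrightarrow> grad u x = deriv U (norm x) *\<^sub>R sgn x"
proof -
  \<comment> \<open>Any unit vector serves; \<open>undefined\<close> merely names some
    coordinate.\<close>
  define e :: "real^'n" where "e = axis undefined 1"
  have e: "norm e = 1" by (simp add: e_def)
  have pos: "0 < r" if "r \<in> ivl R1 R2" for r using that R1 by (auto simp: ivl_def)
  have ne: "norm (r *\<^sub>R e) = r" if "r \<in> ivl R1 R2" for r using pos[OF that] e by simp
  have inA: "r *\<^sub>R e \<in> annulus R1 R2" if "r \<in> ivl R1 R2" for r
    unfolding annulus_vimage using that ne[OF that] by simp
  show D: "(U has_real_derivative deriv U r) (at r)" if r: "r \<in> ivl R1 R2" for r
  proof -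
    have "(u \<circ> (\<lambda>r. r *\<^sub>R e)) differentiable at r"
      using C1 inA[OF r] by (intro differentiable_chain_at) (auto simp: C1_on_def)
    then obtain D where "((u \<circ> (\<lambda>r. r *\<^sub>R e)) has_real_derivative D) (at r)"
      by (auto simp: real_differentiable_def)
    then have "(U has_real_derivative D) (at r)"
      by (rule has_field_derivative_transform_within_open[OF _ open_ivl r]) (use radial inA ne in auto)
    then show ?thesis by (metis DERIV_imp_deriv)
  qed
  show G: "grad u x = deriv U (norm x) *\<^sub>R sgn x" if x: "x \<in> annulus R1 R2" for x
  proof (rule grad_radial[where S = "annulus R1 R2", OF _ open_annulus x])
    have "norm x \<in> ivl R1 R2" using x unfolding annulus_vimage by simp
    then show "x \<noteq> 0" "(U has_real_derivative deriv U (norm x)) (at (norm x))"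
      using pos[of "norm x"] D[of "norm x"] by auto
  qed (rule radial)
  have "continuous_on (ivl R1 R2) (\<lambda>r. grad u (r *\<^sub>R e))"
  proof (rule continuous_on_compose2[of "annulus R1 R2" "grad u"])
    show "continuous_on (annulus R1 R2) (grad u)" using C1 by (simp add: C1_on_def)
    show "(\<lambda>r. r *\<^sub>R e) ` ivl R1 R2 \<subseteq> annulus R1 R2" using inA by (rule image_subsetI)
  qed (intro continuous_intros)
  then have "continuous_on (ivl R1 R2) (\<lambda>r. grad u (r *\<^sub>R e) \<bullet> e)" by (intro continuous_intros)
  then show "continuous_on (ivl R1 R2) (deriv U)"
  proof (rule continuous_on_eq)
    fix r assume r: "r \<in> ivl R1 R2"
    have "sgn (r *\<^sub>R e) = e" using pos[OF r] e by (simp add: sgn_div_norm)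
    then show "grad u (r *\<^sub>R e) \<bullet> e = deriv U r"
      using G[OF inA[OF r]] ne[OF r] e by (simp add: power2_norm_eq_inner[symmetric])
  qed
qed

text \<open>The norm is not differentiable at the origin, but \<open>\<psi>\<close> vanishes for
  radii up to \<open>R1\<close>, so the radial function is zero on a ball around it. The support
  lies in a closed shell.\<close>

lemma Cc1_radial:
  fixes \<psi> :: "real \<Rightarrow> real"
  assumes R1: "0 < R1" and cd: "{c..d} \<subseteq> ivl R1 R2"
    and D: "\<And>r. (\<psi> has_real_derivative \<psi>' r) (at r)" and cont: "continuous_on UNIV \<psi>'"
    and supp: "\<And>r. r \<notin> {c<..<d} \<Longrightarrow> \<psi> r = 0 \<and> \<psi>' r = 0"
  shows "Cc1 (annulus R1 R2) (\<lambda>x::real^'n. \<psi> (norm x))"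
    and "grad (\<lambda>x::real^'n. \<psi> (norm x)) x = \<psi>' (norm x) *\<^sub>R sgn x"
proof -
  let ?\<phi> = "\<lambda>x::real^'n. \<psi> (norm x)"
  have low: "\<psi> r = 0 \<and> \<psi>' r = 0" if "r \<le> R1" for r
  proof (rule supp)
    show "r \<notin> {c<..<d}"
    proof
      assume "r \<in> {c<..<d}"
      then have "r \<in> {c..d}" by auto
      then have "r \<in> ivl R1 R2" using cd by blast
      then show False using that by (auto simp: ivl_def)
    qed
  qed
  have main: "?\<phi> differentiable (at x) \<and> grad ?\<phi> x = \<psi>' (norm x) *\<^sub>R sgn x" for x
  proof (cases "x = 0")
    case True
    have *: "(?\<phi> has_derivative (\<lambda>h. 0)) (at x)"
    proof (rule has_derivative_transform_within_open[of "\<lambda>_. 0" _ _ _ "ball 0 R1"])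
      show "0 = \<psi> (norm y)" if "y \<in> ball 0 R1" for y :: "real^'n"
        using low[of "norm y"] that by simp
    qed (use True R1 in auto)
    have "grad ?\<phi> x = 0"
      unfolding grad_def frechet_derivative_at[OF *, symmetric] by (simp add: vec_eq_iff)
    moreover have "?\<phi> differentiable (at x)" using * by (auto simp: differentiable_def)
    ultimately show ?thesis using True by simp
  next
    case False
    then show ?thesis using grad_radial[of x UNIV ?\<phi> \<psi> "\<psi>' (norm x)"] D by auto
  qed
  then show "grad ?\<phi> x = \<psi>' (norm x) *\<^sub>R sgn x" for x by blast
  \<comment> \<open>Replacing \<open>sgn x\<close> by \<open>x / max R1 (norm x)\<close> removes the
    singularity at the origin and changes nothing where \<open>\<psi>'\<close> is nonzero.\<close>
  have "continuous_on UNIV (\<lambda>x::real^'n. (\<psi>' (norm x) / max R1 (norm x)) *\<^sub>R x)"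
    using R1 by (intro continuous_intros continuous_on_compose2[OF cont]) auto
  moreover have "(\<psi>' (norm x) / max R1 (norm x)) *\<^sub>R x = grad ?\<phi> x" for x
    using main[of x] low[of "norm x"] by (cases "norm x \<le> R1") (auto simp: sgn_div_norm divide_inverse)
  ultimately have "continuous_on UNIV (grad ?\<phi>)" by simp
  then have "C1_on UNIV ?\<phi>" using main by (simp add: C1_on_def)
  moreover have "compact (cball 0 d - ball 0 c :: (real^'n) set)" by (intro compact_diff) auto
  moreover have "cball 0 d - ball 0 c \<subseteq> (annulus R1 R2 :: (real^'n) set)"
    by (auto simp: annulus_vimage intro!: subsetD[OF cd])
  moreover have "\<forall>x::real^'n. x \<notin> cball 0 d - ball 0 c \<longrightarrow> ?\<phi> x = 0" using supp by auto
  ultimately show "Cc1 (annulus R1 R2) ?\<phi>" unfolding Cc1_def by blast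
qed

text \<open>Only \<open>y = 0\<close> is delicate: for \<open>p < 2\<close> the first factor blows
  up there, but the product is bounded by \<open>\<bar>y\<bar> powr (p - 1)\<close>, whose exponent
  is positive.\<close>

lemma continuous_signed_powr:
  fixes p :: real
  assumes "1 < p"
  shows "continuous_on UNIV (\<lambda>y::real. \<bar>y\<bar> powr (p - 2) * y)"
proof -
  have "isCont (\<lambda>y::real. \<bar>y\<bar> powr (p - 2) * y) y" for y
  proof (cases "y = 0")
    case False
    then show ?thesis by (intro continuous_intros) auto
  next
    case True
    have "((\<lambda>y::real. \<bar>y\<bar> powr (p - 2) * y) \<longlongrightarrow> 0) (at 0)"
    proof (rule Lim_null_comparison)
      have "norm (\<bar>y\<bar> powr (p - 2) * y) \<le> \<bar>y\<bar> powr (p - 1)" for y :: real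
      proof (cases "y = 0")
        case False
        have "\<bar>y\<bar> powr (p - 1) = \<bar>y\<bar> powr (p - 2) * \<bar>y\<bar> powr 1" unfolding powr_add[symmetric] by simp
        then show ?thesis using False by (simp add: abs_mult)
      qed simp
      then show "\<forall>\<^sub>F y in at 0. norm (\<bar>y\<bar> powr (p - 2) * y) \<le> \<bar>y\<bar> powr (p - 1)" by simp
      show "((\<lambda>y::real. \<bar>y\<bar> powr (p - 1)) \<longlongrightarrow> 0) (at 0)"
        by (rule tendsto_zero_powrI[where b = "p - 1"]) (use assms in \<open>auto intro!: tendsto_eq_intros\<close>)
    qed
    then show ?thesis using True by (simp add: isCont_def)
  qed
  then show ?thesis by (simp add: continuous_at_imp_continuous_on)
qed

lemma abs_signed_powr: "\<bar>\<bar>y\<bar> powr (p - 2) * y\<bar> = \<bar>y\<bar> powr (p - 1)" for y p :: real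
proof (cases "y = 0")
  case False
  have "\<bar>y\<bar> powr (p - 1) = \<bar>y\<bar> powr (p - 2) * \<bar>y\<bar> powr 1" unfolding powr_add[symmetric] by simp
  then show ?thesis using False by (simp add: abs_mult)
qed simp

text \<open>For a radial test function both gradients are multiples of \<open>sgn x\<close>, so both
  integrands depend on \<open>norm x\<close> alone. Polar coordinates turn \<open>v\<close> and
  \<open>w\<close> into \<open>rho\<close> and \<open>sigma\<close>, and the area of the sphere
  cancels.\<close>

lemma weak_radial_equation:
  fixes u :: "real^'n \<Rightarrow> real"
  assumes R1: "0 < R1" and p: "1 < p"
    and radial: "\<And>x. x \<in> annulus R1 R2 \<Longrightarrow> u x = U (norm x)"
    and C1: "C1_on (annulus R1 R2) u"
    and v: "continuous_on (ivl R1 R2) v" and w: "set_borel_measurable lebesgue (ivl R1 R2) w"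
    and sol: "weak_solution p v w lam (annulus R1 R2) u"
    and cd: "{c..d} \<subseteq> ivl R1 R2"
    and D: "\<And>r. (\<psi> has_real_derivative \<psi>' r) (at r)" and cont: "continuous_on UNIV \<psi>'"
    and supp: "\<And>r. r \<notin> {c<..<d} \<Longrightarrow> \<psi> r = 0 \<and> \<psi>' r = 0"
  shows "(LINT r:ivl R1 R2|lebesgue. rho CARD('n) v r * (\<bar>deriv U r\<bar> powr (p - 2) * deriv U r) * \<psi>' r) =
    (LINT r:ivl R1 R2|lebesgue. lam * (\<bar>U r\<bar> powr (p - 2) * U r * sigma CARD('n) w r) * \<psi> r)"
proof -
  let ?J = "ivl R1 R2" and ?A = "annulus R1 R2 :: (real^'n) set"
  note prof = radial_profile[OF R1 radial C1]
  have test: "Cc1 ?A (\<lambda>x. \<psi> (norm x))" "grad (\<lambda>x. \<psi> (norm x)) x = \<psi>' (norm x) *\<^sub>R sgn x" for x :: "real^'n"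
    by (rule Cc1_radial[OF R1 cd D cont supp]; assumption)+
  \<comment> \<open>Extension by zero outside the interval gives functions on the whole line, as the
    polar coordinate formula requires, and hides the domain of integration in the integrand.\<close>
  define f1 where "f1 r = indicator ?J r * (v r * \<bar>deriv U r\<bar> powr (p - 2) * (deriv U r * \<psi>' r))" for r
  define f2 where "f2 r = indicator ?J r * (w r * \<bar>U r\<bar> powr (p - 2) * U r * \<psi> r)" for r
  have neg: "r < 0 \<Longrightarrow> f1 r = 0" "r < 0 \<Longrightarrow> f2 r = 0" for r
    using R1 by (auto simp: f1_def f2_def ivl_def)
  have contU: "continuous_on ?J U" using prof(1) by (intro DERIV_continuous_on) (auto intro: has_field_derivative_at_within)
  have cont\<psi>: "continuous_on ?J \<psi>" using D by (intro DERIV_continuous_on) (auto intro: has_field_derivative_at_within)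
  have contg: "continuous_on ?J (\<lambda>r. \<bar>g r\<bar> powr (p - 2) * g r)" if "continuous_on ?J g" for g :: "real \<Rightarrow> real"
    using continuous_on_compose2[OF continuous_signed_powr[OF p] that] by auto
  have meas: "(\<lambda>r. indicator ?J r *\<^sub>R g r) \<in> borel_measurable lebesgue" if "continuous_on ?J g" for g :: "real \<Rightarrow> real"
  proof (rule measurable_completion)
    show "(\<lambda>r. indicator ?J r *\<^sub>R g r) \<in> borel_measurable lborel"
      unfolding measurable_lborel2
      using that by (intro borel_measurable_continuous_on_indicator) (auto simp: open_ivl)
  qed
  have m1: "f1 \<in> borel_measurable lebesgue"
  proof -
    have "continuous_on ?J (\<lambda>r. v r * (\<bar>deriv U r\<bar> powr (p - 2) * deriv U r) * \<psi>' r)"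
      by (intro continuous_intros v contg prof(2) continuous_on_subset[OF cont]) auto
    from meas[OF this] show ?thesis unfolding f1_def[abs_def] by (simp add: mult.assoc)
  qed
  have m2: "f2 \<in> borel_measurable lebesgue"
  proof -
    have "continuous_on ?J (\<lambda>r. (\<bar>U r\<bar> powr (p - 2) * U r) * \<psi> r)"
      by (intro continuous_intros contg contU cont\<psi>)
    from borel_measurable_times[OF w[unfolded set_borel_measurable_def] meas[OF this]]
    have "(\<lambda>r. indicator ?J r *\<^sub>R w r * (indicator ?J r *\<^sub>R ((\<bar>U r\<bar> powr (p - 2) * U r) * \<psi> r))) \<in> borel_measurable lebesgue" .
    also have "(\<lambda>r. indicator ?J r *\<^sub>R w r * (indicator ?J r *\<^sub>R ((\<bar>U r\<bar> powr (p - 2) * U r) * \<psi> r))) = f2"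
      by (auto simp: f2_def indicator_def)
    finally show ?thesis .
  qed
  have "(LINT x:?A|lebesgue. v (norm x) * norm (grad u x) powr (p - 2) * (grad u x \<bullet> grad (\<lambda>x. \<psi> (norm x)) x))
      = (LINT x|lebesgue. f1 (norm (x::real^'n)))"
    unfolding set_lebesgue_integral_def
  proof (rule Bochner_Integration.integral_cong)
    fix x :: "real^'n"
    show "indicator ?A x *\<^sub>R (v (norm x) * norm (grad u x) powr (p - 2) * (grad u x \<bullet> grad (\<lambda>x. \<psi> (norm x)) x)) = f1 (norm x)"
    proof (cases "x \<in> ?A")
      case True
      then have "norm x \<in> ?J" by (simp add: annulus_vimage)
      moreover from this R1 have "x \<noteq> 0" by (auto simp: ivl_def)
      then have "norm (sgn x) = 1" by (simp add: norm_sgn)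
      then have "sgn x \<bullet> sgn x = 1" by (simp add: norm_eq_1)
      ultimately show ?thesis using True \<open>norm (sgn x) = 1\<close>
        by (simp add: prof(3) test(2) f1_def)
    next
      case False
      then show ?thesis by (simp add: annulus_vimage f1_def)
    qed
  qed simp
  also have "\<dots> = sphere_area TYPE(real^'n) * (LINT r|lebesgue. r ^ (CARD('n) - 1) * f1 r)"
    using integral_norm_lebesgue[OF m1 neg(1), where 'a="real^'n"] by simp
  also have "(LINT r|lebesgue. r ^ (CARD('n) - 1) * f1 r) =
      (LINT r:?J|lebesgue. rho CARD('n) v r * (\<bar>deriv U r\<bar> powr (p - 2) * deriv U r) * \<psi>' r)"
    unfolding set_lebesgue_integral_def
    by (intro Bochner_Integration.integral_cong) (auto simp: f1_def rho_def mult_ac)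
  finally have L: "(LINT x:?A|lebesgue. v (norm x) * norm (grad u x) powr (p - 2) * (grad u x \<bullet> grad (\<lambda>x. \<psi> (norm x)) x))
     = sphere_area TYPE(real^'n) * (LINT r:?J|lebesgue. rho CARD('n) v r * (\<bar>deriv U r\<bar> powr (p - 2) * deriv U r) * \<psi>' r)" .
  have "(LINT x:?A|lebesgue. w (norm x) * \<bar>u x\<bar> powr (p - 2) * u x * \<psi> (norm x))
      = (LINT x|lebesgue. f2 (norm (x::real^'n)))"
    unfolding set_lebesgue_integral_def
  proof (rule Bochner_Integration.integral_cong)
    fix x :: "real^'n"
    show "indicator ?A x *\<^sub>R (w (norm x) * \<bar>u x\<bar> powr (p - 2) * u x * \<psi> (norm x)) = f2 (norm x)"
      using radial[of x] by (cases "x \<in> ?A") (auto simp: annulus_vimage f2_def)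
  qed simp
  also have "\<dots> = sphere_area TYPE(real^'n) * (LINT r|lebesgue. r ^ (CARD('n) - 1) * f2 r)"
    using integral_norm_lebesgue[OF m2 neg(2), where 'a="real^'n"] by simp
  finally have Rr: "(LINT x:?A|lebesgue. w (norm x) * \<bar>u x\<bar> powr (p - 2) * u x * \<psi> (norm x))
     = sphere_area TYPE(real^'n) * (LINT r|lebesgue. r ^ (CARD('n) - 1) * f2 r)" .
  have "(LINT x:?A|lebesgue. v (norm x) * norm (grad u x) powr (p - 2) * (grad u x \<bullet> grad (\<lambda>x. \<psi> (norm x)) x))
      = lam * (LINT x:?A|lebesgue. w (norm x) * \<bar>u x\<bar> powr (p - 2) * u x * \<psi> (norm x))"
    using sol test(1) unfolding weak_solution_def by blast
  then have "(LINT r:?J|lebesgue. rho CARD('n) v r * (\<bar>deriv U r\<bar> powr (p - 2) * deriv U r) * \<psi>' r)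
      = lam * (LINT r|lebesgue. r ^ (CARD('n) - 1) * f2 r)"
    unfolding L Rr using sphere_area_pos[where 'a="real^'n"] by simp
  also have "\<dots> = (LINT r|lebesgue. lam * (r ^ (CARD('n) - 1) * f2 r))" by simp
  also have "\<dots> = (LINT r:?J|lebesgue. lam * (\<bar>U r\<bar> powr (p - 2) * U r * sigma CARD('n) w r) * \<psi> r)"
    unfolding set_lebesgue_integral_def
    by (intro Bochner_Integration.integral_cong) (auto simp: f2_def sigma_def mult_ac)
  finally show ?thesis .
qed

section \<open>Half-linear systems\<close>

text \<open>Comparison with twice the maximum works for every exponent, so \<open>p < 2\<close> and
  \<open>p > 2\<close> need no separate convexity and concavity arguments.\<close>

lemma powr_add_le2:
  fixes x y q :: real
  assumes "0 \<le> x" "0 \<le> y" "0 \<le> q"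
  shows "(x + y) powr q \<le> 2 powr q * (x powr q + y powr q)"
proof -
  have "(x + y) powr q \<le> (2 * max x y) powr q" using assms by (intro powr_mono2) auto
  also have "\<dots> = 2 powr q * max x y powr q" using assms by (simp add: powr_mult)
  also have "\<dots> \<le> 2 powr q * (x powr q + y powr q)" by (intro mult_left_mono) (auto simp: max_def)
  finally show ?thesis .
qed

lemma powr_add_le3:
  fixes x y z q :: real
  assumes "0 \<le> x" "0 \<le> y" "0 \<le> z" "0 \<le> q"
  shows "(x + y + z) powr q \<le> 3 powr q * (x powr q + y powr q + z powr q)"
proof -
  have "(x + y + z) powr q \<le> (3 * max x (max y z)) powr q" using assms by (intro powr_mono2) auto
  also have "\<dots> = 3 powr q * max x (max y z) powr q" using assms by (simp add: powr_mult)
  also have "\<dots> \<le> 3 powr q * (x powr q + y powr q + z powr q)"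
    by (intro mult_left_mono) (auto simp: max_def)
  finally show ?thesis .
qed

lemma tendsto_powr_at_right_0:
  fixes c :: real
  assumes "0 < c"
  shows "((\<lambda>y. y powr c) \<longlongrightarrow> 0) (at_right 0)"
  by (rule tendsto_zero_powrI[where b = c]) (use assms in \<open>auto simp: eventually_at_filter\<close>)

text \<open>Integral inequalities instead of differential equations: the identity for
  \<open>U'\<close> may fail on a null set, and signs do not matter for uniqueness or smallness.
  Nonnegativity of \<open>s\<close> at every point is met by taking
  \<open>\<bar>\<sigma>\<bar>\<close>, as \<open>\<sigma>\<close> is positive only a.e.\<close>

locale half_linear_system =
  fixes p lam :: real and J :: "real set" and h s U F :: "real \<Rightarrow> real"
  assumes p: "1 < p" and lam: "0 < lam"
    and J: "open J" "is_interval J"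
    and h: "\<And>a b. {a..b} \<subseteq> J \<Longrightarrow> h integrable_on {a..b}" "\<And>r. 0 \<le> h r"
    and s: "\<And>a b. {a..b} \<subseteq> J \<Longrightarrow> s integrable_on {a..b}" "\<And>r. 0 \<le> s r"
    and contU: "continuous_on J U" and contF: "continuous_on J F"
    and U_diff: "\<And>a b. a \<le> b \<Longrightarrow> {a..b} \<subseteq> J \<Longrightarrow>
      \<bar>U b - U a\<bar> \<le> integral {a..b} (\<lambda>r. \<bar>F r\<bar> powr (1 / (p - 1)) * h r)"
    and F_diff: "\<And>a b. a \<le> b \<Longrightarrow> {a..b} \<subseteq> J \<Longrightarrow>
      \<bar>F b - F a\<bar> \<le> lam * integral {a..b} (\<lambda>r. \<bar>U r\<bar> powr (p - 1) * s r)"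
begin

lemma subJ: "a \<in> J \<Longrightarrow> b \<in> J \<Longrightarrow> {a..b} \<subseteq> J"
  using J(2) unfolding is_interval_1 by (meson atLeastAtMost_iff subsetI)

lemma integrable_mult_h:
  assumes "{a..b} \<subseteq> J" "continuous_on {a..b} f"
  shows "(\<lambda>r. f r * h r) integrable_on {a..b}"
  using absolutely_integrable_continuous_mult[OF assms(2)] nonnegative_absolutely_integrable_1[OF h(1)[OF assms(1)]] h(2)
    absolutely_integrable_on_def by blast

lemma integrable_mult_s:
  assumes "{a..b} \<subseteq> J" "continuous_on {a..b} f"
  shows "(\<lambda>r. f r * s r) integrable_on {a..b}"
  using absolutely_integrable_continuous_mult[OF assms(2)] nonnegative_absolutely_integrable_1[OF s(1)[OF assms(1)]] s(2)
    absolutely_integrable_on_def by blast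

lemma continuous_powr_abs_F: "{a..b} \<subseteq> J \<Longrightarrow> continuous_on {a..b} (\<lambda>r. \<bar>F r\<bar> powr (1 / (p - 1)))"
  using p by (intro continuous_on_powr' continuous_intros continuous_on_subset[OF contF]) auto

lemma continuous_powr_abs_U: "{a..b} \<subseteq> J \<Longrightarrow> continuous_on {a..b} (\<lambda>r. \<bar>U r\<bar> powr (p - 1))"
  using p by (intro continuous_on_powr' continuous_intros continuous_on_subset[OF contU]) auto

lemma U_diff_const:
  assumes "{A..B} \<subseteq> J" "x \<in> {A..B}" "y \<in> {A..B}" and m: "\<And>r. r \<in> {A..B} \<Longrightarrow> \<bar>F r\<bar> \<le> m"
  shows "\<bar>U x - U y\<bar> \<le> m powr (1 / (p - 1)) * integral {A..B} h"
  using assms(2,3)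
proof (induction x y rule: linorder_wlog)
  case (le x y)
  then have sub: "{x..y} \<subseteq> J" "{x..y} \<subseteq> {A..B}" using assms by auto
  have "\<bar>U y - U x\<bar> \<le> integral {x..y} (\<lambda>r. \<bar>F r\<bar> powr (1 / (p - 1)) * h r)"
    using U_diff le sub by auto
  also have "\<dots> \<le> integral {x..y} (\<lambda>r. m powr (1 / (p - 1)) * h r)"
    using m sub h p by (intro integral_le integrable_mult_h continuous_powr_abs_F continuous_intros mult_right_mono powr_mono2) auto
  also have "\<dots> = m powr (1 / (p - 1)) * integral {x..y} h" by simp
  also have "\<dots> \<le> m powr (1 / (p - 1)) * integral {A..B} h"
    using h sub assms by (intro mult_left_mono integral_subset_le) auto
  finally show ?case by (simp add: abs_minus_commute)
qed (simp add: abs_minus_commute)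

lemma F_diff_const:
  assumes "{A..B} \<subseteq> J" "x \<in> {A..B}" "y \<in> {A..B}" and m: "\<And>r. r \<in> {A..B} \<Longrightarrow> \<bar>U r\<bar> \<le> m"
  shows "\<bar>F x - F y\<bar> \<le> lam * (m powr (p - 1) * integral {A..B} s)"
  using assms(2,3)
proof (induction x y rule: linorder_wlog)
  case (le x y)
  then have sub: "{x..y} \<subseteq> J" "{x..y} \<subseteq> {A..B}" using assms by auto
  have "\<bar>F y - F x\<bar> \<le> lam * integral {x..y} (\<lambda>r. \<bar>U r\<bar> powr (p - 1) * s r)"
    using F_diff le sub by auto
  also have "\<dots> \<le> lam * integral {x..y} (\<lambda>r. m powr (p - 1) * s r)"
    using m sub s p lam by (intro mult_left_mono integral_le integrable_mult_s continuous_powr_abs_U continuous_intros mult_right_mono powr_mono2) auto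
  also have "\<dots> = lam * (m powr (p - 1) * integral {x..y} s)" by simp
  also have "\<dots> \<le> lam * (m powr (p - 1) * integral {A..B} s)"
    using s sub assms lam by (intro mult_left_mono integral_subset_le) auto
  finally show ?case by (simp add: abs_minus_commute)
qed (simp add: abs_minus_commute)

text \<open>If \<open>M\<close> is the maximum of \<open>\<bar>U\<bar>\<close> near
  \<open>r0\<close>, the flux is at most a constant times \<open>M powr (p - 1)\<close>, and the
  exponent \<open>1 / (p - 1)\<close> in the other inequality turns this back into a multiple of
  \<open>M\<close>. On a short interval the multiple is at most \<open>1/2\<close>, so
  \<open>M = 0\<close>.\<close>

lemma zero_locally:
  assumes r0: "r0 \<in> J" "U r0 = 0" "F r0 = 0"
  shows "\<exists>d>0. \<forall>r. \<bar>r - r0\<bar> < d \<longrightarrow> r \<in> J \<and> U r = 0 \<and> F r = 0"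
proof -
  obtain e where e: "e > 0" "{r0-e..r0+e} \<subseteq> J"
    using J(1)[unfolded open_contains_cball] r0(1) by (auto simp: cball_eq_atLeastAtMost)
  define Sl where "Sl = integral {r0-e..r0+e} s"
  have Sl: "0 \<le> Sl" unfolding Sl_def using s e by (intro Henstock_Kurzweil_Integration.integral_nonneg) auto
  define c where "c = (lam * Sl) powr (1 / (p - 1))"
  have c: "0 \<le> c" by (simp add: c_def)
  define I where "I x = integral {r0-e..x} h" for x
  have contI: "continuous_on {r0-e..r0+e} I" unfolding I_def
    by (intro indefinite_integral_continuous_1 h e)
  \<comment> \<open>The increments of \<open>I\<close> on the two sides of \<open>r0\<close> add up
    to at most \<open>1 / (2 * (c + 1))\<close>, so the factor \<open>c\<close> leaves at most
    \<open>M / 2\<close>; the summand 1 covers \<open>c = 0\<close>.\<close>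
  obtain d0 where d0: "d0 > 0" "\<And>x. x \<in> {r0-e..r0+e} \<Longrightarrow> dist x r0 < d0 \<Longrightarrow> dist (I x) (I r0) < 1 / (4 * (c + 1))"
    using contI[unfolded continuous_on_iff, rule_format, of r0 "1 / (4 * (c + 1))"] e c by auto
  define d where "d = min e (d0/2)"
  have d: "d > 0" "d \<le> e" "d < d0" using e d0 by (auto simp: d_def)
  let ?K = "{r0-d..r0+d}"
  have sub: "?K \<subseteq> J" "?K \<subseteq> {r0-e..r0+e}" using e d by auto
  have "h integrable_on {r0-e..r0+d}" using h(1)[OF e(2)] by (rule integrable_on_subinterval) (use d in auto)
  then have "I (r0 - d) + integral ?K h = I (r0 + d)"
    unfolding I_def using d by (intro Henstock_Kurzweil_Integration.integral_combine) auto
  moreover have "dist (I (r0-d)) (I r0) < 1 / (4 * (c + 1))" "dist (I (r0+d)) (I r0) < 1 / (4 * (c + 1))"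
    using d by (intro d0; auto simp: dist_real_def)+
  ultimately have "integral ?K h \<le> 2 * (1 / (4 * (c + 1)))"
    unfolding dist_real_def by linarith
  then have Kh: "integral ?K h \<le> 1 / (2 * (c + 1))" using c by (simp add: field_simps)
  have "\<exists>x\<in>?K. \<forall>y\<in>?K. \<bar>U y\<bar> \<le> \<bar>U x\<bar>"
    using d by (intro continuous_attains_sup continuous_intros continuous_on_subset[OF contU] sub) auto
  then obtain x where x: "x \<in> ?K" "\<And>y. y \<in> ?K \<Longrightarrow> \<bar>U y\<bar> \<le> \<bar>U x\<bar>" by blast
  define M where "M = \<bar>U x\<bar>"
  have M: "0 \<le> M" by (simp add: M_def)
  have r0K: "r0 \<in> ?K" using d by auto
  have Fb: "\<bar>F y\<bar> \<le> lam * Sl * M powr (p - 1)" if "y \<in> ?K" for y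
  proof -
    have "\<bar>F y - F r0\<bar> \<le> lam * (M powr (p - 1) * integral ?K s)"
      using F_diff_const[OF sub(1) that r0K, of M] x by (auto simp: M_def)
    also have "\<dots> \<le> lam * (M powr (p - 1) * Sl)"
      unfolding Sl_def using s sub e lam by (intro mult_left_mono integral_subset_le) auto
    finally show ?thesis using r0 by (simp add: mult_ac)
  qed
  have "M \<le> (lam * Sl * M powr (p - 1)) powr (1 / (p - 1)) * integral ?K h"
    using U_diff_const[OF sub(1) x(1) r0K Fb] r0 by (auto simp: M_def)
  also have "\<dots> = c * M * integral ?K h"
    using lam Sl p M by (simp add: powr_mult powr_powr c_def)
  also have "\<dots> \<le> c * M * (1 / (2 * (c + 1)))"
    using Kh c M by (intro mult_left_mono) auto
  also have "\<dots> \<le> M / 2" using c M by (simp add: field_simps)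
  finally have "M = 0" using M by simp
  then have "U r = 0 \<and> F r = 0" if "r \<in> ?K" for r
    using x(2)[OF that] Fb[OF that] p by (auto simp: M_def)
  moreover have "r \<in> ?K" if "\<bar>r - r0\<bar> < d" for r using that by auto
  ultimately show ?thesis using d(1) sub(1) by (intro exI[of _ d] conjI allI impI) (auto dest: subsetD)
qed

text \<open>The common zeros of \<open>U\<close> and \<open>F\<close> form a set that is closed in
  \<open>J\<close> by continuity and open by local uniqueness; \<open>J\<close> is
  connected.\<close>

lemma zero_globally:
  assumes r0: "r0 \<in> J" "U r0 = 0" "F r0 = 0" and r: "r \<in> J"
  shows "U r = 0"
proof -
  let ?Z = "{r \<in> J. (U r, F r) = (0, 0)}"
  have "open ?Z"
    unfolding open_dist
  proof
    fix x assume "x \<in> ?Z"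
    then obtain d where "d > 0" "\<forall>r. \<bar>r - x\<bar> < d \<longrightarrow> r \<in> J \<and> U r = 0 \<and> F r = 0"
      using zero_locally[of x] by auto
    then show "\<exists>e>0. \<forall>y. dist y x < e \<longrightarrow> y \<in> ?Z"
      by (intro exI[of _ d]) (simp add: dist_real_def)
  qed
  then have op: "openin (top_of_set J) ?Z" by (intro open_subset) auto
  have cl: "closedin (top_of_set J) ?Z"
    by (intro continuous_closedin_preimage_constant continuous_intros contU contF)
  have "connected J" using J(2) is_interval_connected by blast
  then have "\<forall>T. openin (top_of_set J) T \<and> closedin (top_of_set J) T \<longrightarrow> T = {} \<or> T = J"
    by (rule iffD1[OF connected_clopen])
  from this[THEN spec, THEN mp, OF conjI[OF op cl]]
  show ?thesis
  proof
    assume "?Z = {}"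
    then show ?thesis using r0 by auto
  next
    assume "?Z = J"
    with r have "r \<in> ?Z" by simp
    then show ?thesis by simp
  qed
qed


text \<open>Since \<open>- H\<close> increases with density \<open>h\<close>, the integrand has the
  antiderivative \<open>- (H powr \<beta>) / \<beta>\<close>. The bound is independent of
  \<open>b\<close>, although for \<open>\<beta> < 1\<close> the power of \<open>H\<close> blows up
  as \<open>H\<close> tends to 0.\<close>

lemma tail_integral_h:
  assumes a: "a \<in> J" "b \<in> J" "a \<le> b" and \<beta>: "0 < \<beta>"
    and H: "\<And>x. x \<in> {a..b} \<Longrightarrow> H a - H x = integral {a..x} h" "\<And>x. x \<in> {a..b} \<Longrightarrow> 0 < H x"
  shows "(\<lambda>r. H r powr (\<beta> - 1) * h r) integrable_on {a..b}"
    and "integral {a..b} (\<lambda>r. H r powr (\<beta> - 1) * h r) \<le> H a powr \<beta> / \<beta>"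
proof -
  note sub = subJ[OF a(1,2)]
  have G: "- H x = - H a + integral {a..x} h" if "x \<in> {a..b}" for x using H(1)[OF that] by simp
  have d: "((\<lambda>y. - ((- y) powr \<beta>) / \<beta>) has_real_derivative (- y) powr (\<beta> - 1)) (at y)"
    if "y \<in> (\<lambda>x. - H x) ` {a..b}" for y
    using that H(2) \<beta> by (auto intro!: derivative_eq_intros)
  have c: "continuous_on ((\<lambda>x. - H x) ` {a..b}) (\<lambda>y. (- y) powr (\<beta> - 1))"
    by (intro continuous_intros) (fastforce dest: H(2))
  note * = integral_chain_rule[OF a(3) h(1)[OF sub] h(2) G d c]
  show "(\<lambda>r. H r powr (\<beta> - 1) * h r) integrable_on {a..b}" using *(1) by simp
  show "integral {a..b} (\<lambda>r. H r powr (\<beta> - 1) * h r) \<le> H a powr \<beta> / \<beta>" using *(2) \<beta> by simp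
qed

text \<open>The antiderivative is \<open>- (S powr (1 - \<gamma>)) / (\<gamma> - 1)\<close>. As
  \<open>\<gamma> > 1\<close>, the bound is uniform in \<open>b\<close> even if \<open>S\<close> is
  unbounded.\<close>

lemma tail_integral_s:
  assumes a: "a \<in> J" "b \<in> J" "a \<le> b" and \<gamma>: "1 < \<gamma>"
    and S: "\<And>x. x \<in> {a..b} \<Longrightarrow> S x = S a + integral {a..x} s" "0 < S a"
  shows "(\<lambda>r. S r powr (- \<gamma>) * s r) integrable_on {a..b}"
    and "integral {a..b} (\<lambda>r. S r powr (- \<gamma>) * s r) \<le> S a powr (1 - \<gamma>) / (\<gamma> - 1)"
proof -
  note sub = subJ[OF a(1,2)]
  have pos: "0 < S x" if x: "x \<in> {a..b}" for x
  proof -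
    have "{a..x} \<subseteq> J" using sub x by auto
    then have "0 \<le> integral {a..x} s" using s by (intro Henstock_Kurzweil_Integration.integral_nonneg) auto
    then show ?thesis using S(1)[OF x] S(2) by linarith
  qed
  have d: "((\<lambda>y. - (y powr (1 - \<gamma>)) / (\<gamma> - 1)) has_real_derivative y powr (- \<gamma>)) (at y)"
    if "y \<in> S ` {a..b}" for y
  proof -
    have "0 < y" using that pos by auto
    with \<gamma> have "((\<lambda>y. - (y powr (1 - \<gamma>)) / (\<gamma> - 1)) has_real_derivative - ((1 - \<gamma>) * y powr (1 - \<gamma> - 1)) / (\<gamma> - 1)) (at y)"
      by (auto intro!: derivative_eq_intros)
    moreover have "- ((1 - \<gamma>) * y powr (1 - \<gamma> - 1)) / (\<gamma> - 1) = y powr (- \<gamma>)"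
      using \<gamma> by (simp add: field_simps)
    ultimately show ?thesis by simp
  qed
  have c: "continuous_on (S ` {a..b}) (\<lambda>y. y powr (- \<gamma>))"
    by (intro continuous_intros) (fastforce dest: pos)
  note * = integral_chain_rule[OF a(3) s(1)[OF sub] s(2) S(1) d c]
  show "(\<lambda>r. S r powr (- \<gamma>) * s r) integrable_on {a..b}" using *(1) by simp
  show "integral {a..b} (\<lambda>r. S r powr (- \<gamma>) * s r) \<le> S a powr (1 - \<gamma>) / (\<gamma> - 1)"
    using *(2) \<gamma> by simp
qed

end

text \<open>The right end point does not occur: \<open>H_small\<close> and \<open>U_small\<close>
  express the limits through points of \<open>J\<close>, so finite and infinite \<open>R2\<close>
  are treated alike.\<close>

locale half_linear_tail = half_linear_system +
  fixes \<xi> \<epsilon> C :: real and H :: "real \<Rightarrow> real"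
  assumes \<xi>: "\<xi> \<in> J"
    and \<epsilon>: "0 < \<epsilon>" "\<epsilon> < p - 1" and C: "0 < C"
    and H_diff: "\<And>a b. \<xi> \<le> a \<Longrightarrow> a \<le> b \<Longrightarrow> b \<in> J \<Longrightarrow> H a - H b = integral {a..b} h"
    and H_pos: "\<And>r. r \<in> J \<Longrightarrow> \<xi> \<le> r \<Longrightarrow> 0 < H r"
    and H_small: "\<And>e. 0 < e \<Longrightarrow> \<exists>a\<in>J. \<xi> < a \<and> H a < e"
    and s_pos: "\<And>r. r \<in> J \<Longrightarrow> \<xi> < r \<Longrightarrow> 0 < integral {\<xi>..r} s"
    and growth: "\<And>r. r \<in> J \<Longrightarrow> \<xi> < r \<Longrightarrow> integral {\<xi>..r} s * H r powr \<epsilon> \<le> C"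
    and U_small: "\<And>e. 0 < e \<Longrightarrow> \<exists>a\<in>J. \<forall>r\<in>J. a \<le> r \<longrightarrow> \<bar>U r\<bar> \<le> e"
begin

definition S where "S r = integral {\<xi>..r} s"

lemma H_antimono: "\<xi> \<le> a \<Longrightarrow> a \<le> b \<Longrightarrow> b \<in> J \<Longrightarrow> H b \<le> H a"
proof -
  assume a: "\<xi> \<le> a" "a \<le> b" "b \<in> J"
  have "{a..b} \<subseteq> J" using subJ[OF \<xi> a(3)] a by auto
  then have "0 \<le> integral {a..b} h" using h by (intro Henstock_Kurzweil_Integration.integral_nonneg) auto
  then show ?thesis using H_diff[OF a] by simp
qed

lemma S_add: "\<xi> \<le> a \<Longrightarrow> a \<le> b \<Longrightarrow> b \<in> J \<Longrightarrow> S b = S a + integral {a..b} s"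
  unfolding S_def using s(1)[OF subJ[OF \<xi>]]
  by (simp add: Henstock_Kurzweil_Integration.integral_combine)

lemma S_mono: "\<xi> \<le> a \<Longrightarrow> a \<le> b \<Longrightarrow> b \<in> J \<Longrightarrow> S a \<le> S b"
proof -
  assume a: "\<xi> \<le> a" "a \<le> b" "b \<in> J"
  have "{a..b} \<subseteq> J" using subJ[OF \<xi> a(3)] a by auto
  then have "0 \<le> integral {a..b} s" using s by (intro Henstock_Kurzweil_Integration.integral_nonneg) auto
  then show ?thesis using S_add[OF a] by simp
qed

lemma S_le: "r \<in> J \<Longrightarrow> \<xi> < r \<Longrightarrow> S r \<le> C * H r powr (- \<epsilon>)"
  using growth[of r] H_pos[of r] by (simp add: S_def powr_minus field_simps)

lemma contH: "\<xi> \<le> a \<Longrightarrow> b \<in> J \<Longrightarrow> continuous_on {a..b} H"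
proof -
  assume a: "\<xi> \<le> a" "b \<in> J"
  show ?thesis
  proof (cases "a \<le> b")
    case True
    have "{a..b} \<subseteq> J" using subJ[OF \<xi> a(2)] a by auto
    then have "continuous_on {a..b} (\<lambda>x. H a - integral {a..x} h)"
      by (intro continuous_intros indefinite_integral_continuous_1 h)
    then show ?thesis
    proof (rule continuous_on_eq)
      fix x assume x: "x \<in> {a..b}"
      then have "x \<in> J" using \<open>{a..b} \<subseteq> J\<close> by auto
      then show "H a - integral {a..x} h = H x" using H_diff[of a x] a x by auto
    qed
  qed auto
qed

text \<open>The growth condition is read as \<open>H \<le> (C / S)^(1/\<epsilon>)\<close>; taking \<open>\<delta>\<close> strictly between \<open>\<epsilon>\<close> and
  \<open>p - 1\<close> makes \<open>s S^(-\<delta>/\<epsilon>)\<close> integrable and leaves a positive power of \<open>H a\<close>.\<close>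

lemma weighted_tail_small:
  obtains K0 \<beta> a0 where "0 \<le> K0" "0 < \<beta>" "a0 \<in> J" "\<xi> < a0"
    "\<And>a r. a0 \<le> a \<Longrightarrow> a \<le> r \<Longrightarrow> r \<in> J \<Longrightarrow> integral {a..r} (\<lambda>t. H t powr (p - 1) * s t) \<le> K0 * H a powr \<beta>"
proof -
  define \<delta> where "\<delta> = (\<epsilon> + (p - 1)) / 2"
  define \<gamma> where "\<gamma> = \<delta> / \<epsilon>"
  have \<delta>: "\<epsilon> < \<delta>" "\<delta> < p - 1" "0 < \<delta>" using \<epsilon> by (auto simp: \<delta>_def field_simps)
  have \<gamma>: "1 < \<gamma>" using \<delta> \<epsilon> by (auto simp: \<gamma>_def field_simps)
  have \<epsilon>\<gamma>: "\<epsilon> * \<gamma> = \<delta>" using \<epsilon> by (simp add: \<gamma>_def)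
  \<comment> \<open>Here \<open>H_small\<close> only supplies a point to the right of
    \<open>\<xi>\<close>. At \<open>\<xi>\<close> itself \<open>S\<close> is 0, and
    \<open>K0\<close> contains a negative power of \<open>S a0\<close>; fixing \<open>a0\<close>
    also keeps \<open>K0\<close> independent of \<open>a\<close>.\<close>
  obtain a0 where a0: "a0 \<in> J" "\<xi> < a0" using H_small[of 1] by auto
  define K0 where "K0 = C powr \<gamma> * (S a0 powr (1 - \<gamma>) / (\<gamma> - 1))"
  show ?thesis
  proof
    show "0 \<le> K0" using \<gamma> by (auto simp: K0_def)
    show "0 < p - 1 - \<delta>" using \<delta> by simp
    fix a r assume ar: "a0 \<le> a" "a \<le> r" "r \<in> J"
    have sub0: "{\<xi>..r} \<subseteq> J" using subJ[OF \<xi> ar(3)] .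
    have sub: "{a..r} \<subseteq> J" using sub0 ar a0 by auto
    have aJ: "a \<in> J" using sub ar by auto
    have Sa: "0 < S a0" "S a0 \<le> S a" using s_pos[OF a0] S_mono[of a0 a] ar a0 aJ by (auto simp: S_def)
    have Sadd: "S x = S a + integral {a..x} s" if "x \<in> {a..r}" for x
      using S_add[of a x] that ar a0 sub by auto
    note tail = tail_integral_s[OF aJ ar(3) ar(2) \<gamma> Sadd]
    \<comment> \<open>The exponent \<open>p - 1\<close> is split: \<open>p - 1 - \<delta>\<close> is
      spent on \<open>H t \<le> H a\<close>, and \<open>\<delta> = \<epsilon> * \<gamma>\<close> on
      the growth condition.\<close>
    have pt: "H t powr (p - 1) \<le> H a powr (p - 1 - \<delta>) * C powr \<gamma> * S t powr (- \<gamma>)" if t: "t \<in> {a..r}" for t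
    proof -
      have tJ: "t \<in> J" "\<xi> < t" using t sub ar a0 by auto
      have Ht: "0 < H t" "H t \<le> H a" using H_pos[of t] H_antimono[of a t] tJ t ar a0 by auto
      have St: "0 < S t" using s_pos[OF tJ] by (simp add: S_def)
      have "H t powr \<epsilon> \<le> C / S t" using growth[OF tJ] St by (simp add: S_def field_simps)
      then have "(H t powr \<epsilon>) powr \<gamma> \<le> (C / S t) powr \<gamma>" using \<gamma> by (intro powr_mono2) auto
      then have 1: "H t powr \<delta> \<le> C powr \<gamma> * S t powr (- \<gamma>)"
        using C St \<epsilon>\<gamma> by (simp add: powr_powr powr_divide powr_minus field_simps)
      have "H t powr (p - 1) = H t powr (p - 1 - \<delta>) * H t powr \<delta>" by (simp flip: powr_add)
      also have "\<dots> \<le> H a powr (p - 1 - \<delta>) * (C powr \<gamma> * S t powr (- \<gamma>))"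
        using 1 Ht \<delta> by (intro mult_mono powr_mono2) auto
      finally show ?thesis by (simp add: mult.assoc)
    qed
    have "integral {a..r} (\<lambda>t. H t powr (p - 1) * s t)
        \<le> integral {a..r} (\<lambda>t. H a powr (p - 1 - \<delta>) * C powr \<gamma> * (S t powr (- \<gamma>) * s t))"
    proof (rule integral_le)
      show "(\<lambda>t. H t powr (p - 1) * s t) integrable_on {a..r}"
      proof (intro integrable_mult_s sub continuous_on_powr' continuous_intros contH)
        show "\<forall>x\<in>{a..r}. 0 \<le> H x \<and> (H x = 0 \<longrightarrow> 0 < p - 1)"
        proof
          fix x assume "x \<in> {a..r}"
          then have "0 < H x" using H_pos[of x] sub ar a0 by auto
          then show "0 \<le> H x \<and> (H x = 0 \<longrightarrow> 0 < p - 1)" by simp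
        qed
      qed (use ar a0 in auto)
      show "(\<lambda>t. H a powr (p - 1 - \<delta>) * C powr \<gamma> * (S t powr (- \<gamma>) * s t)) integrable_on {a..r}"
        using tail(1) Sa by (intro integrable_on_mult_right) auto
      fix t assume t: "t \<in> {a..r}"
      show "H t powr (p - 1) * s t \<le> H a powr (p - 1 - \<delta>) * C powr \<gamma> * (S t powr (- \<gamma>) * s t)"
        using mult_right_mono[OF pt[OF t] s(2)[of t]] by (simp add: mult.assoc)
    qed
    also have "\<dots> = H a powr (p - 1 - \<delta>) * C powr \<gamma> * integral {a..r} (\<lambda>t. S t powr (- \<gamma>) * s t)"
      by (rule integral_mult_right)
    also have "\<dots> \<le> H a powr (p - 1 - \<delta>) * C powr \<gamma> * (S a powr (1 - \<gamma>) / (\<gamma> - 1))"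
      using tail(2) Sa by (intro mult_left_mono) auto
    also have "\<dots> \<le> H a powr (p - 1 - \<delta>) * C powr \<gamma> * (S a0 powr (1 - \<gamma>) / (\<gamma> - 1))"
      using Sa \<gamma> by (intro mult_left_mono divide_right_mono powr_mono2') auto
    finally show "integral {a..r} (\<lambda>t. H t powr (p - 1) * s t) \<le> K0 * H a powr (p - 1 - \<delta>)"
      by (simp add: K0_def mult_ac)
  qed (use a0 in auto)
qed

text \<open>A bound \<open>X\<close> for \<open>\<bar>U\<bar>\<close> relative to the weight enters
  the flux as \<open>X powr (p - 1)\<close> and, after the power \<open>1 / (p - 1)\<close>, the
  next bound for \<open>U\<close> linearly. For small \<open>H a\<close> its coefficient is at most
  \<open>1/2\<close>, so it can be absorbed and only the flux at \<open>a\<close> remains.\<close>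

lemma flux_controlled:
  obtains a c where "a \<in> J" "\<xi> < a"
    "\<And>r. r \<in> J \<Longrightarrow> a \<le> r \<Longrightarrow> \<bar>U r\<bar> \<le> c * \<bar>F a\<bar> powr (1 / (p - 1)) * H r"
    "\<And>r. r \<in> J \<Longrightarrow> a \<le> r \<Longrightarrow> \<bar>F r - F a\<bar> \<le> \<bar>F a\<bar> / 2"
proof -
  define q where "q = 1 / (p - 1)"
  have q: "0 < q" "(p - 1) * q = 1" "q * (p - 1) = 1" "\<epsilon> * q < 1" using p \<epsilon> by (auto simp: q_def field_simps)
  \<comment> \<open>\<open>T\<close> comes from splitting the power of a sum of three flux terms,
    \<open>B\<close> from the power \<open>q\<close> of the factor
    \<open>lam * 2 powr (p - 1)\<close> in front of \<open>X powr (p - 1)\<close>.\<close>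
  define T B where "T = 3 powr q" and "B = (lam * 2 powr (p - 1)) powr q"
  have TB: "0 < T" "0 < B" using lam by (auto simp: T_def B_def)
  obtain K0 \<beta> a0 where K0: "0 \<le> K0" "0 < \<beta>" "a0 \<in> J" "\<xi> < a0"
    and Kint: "\<And>a r. a0 \<le> a \<Longrightarrow> a \<le> r \<Longrightarrow> r \<in> J \<Longrightarrow> integral {a..r} (\<lambda>t. H t powr (p - 1) * s t) \<le> K0 * H a powr \<beta>"
    by (rule weighted_tail_small) (rule that; assumption)
  \<comment> \<open>The exponent left after integrating
    \<open>H powr (- \<epsilon> * q) * h\<close>; it is positive exactly because
    \<open>\<epsilon> < p - 1\<close>.\<close>
  define \<mu> where "\<mu> = 1 - \<epsilon> * q"
  have \<mu>: "0 < \<mu>" "\<mu> - 1 = - \<epsilon> * q" using q by (auto simp: \<mu>_def)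
  \<comment> \<open>With \<open>y = H a\<close>, this is the coefficient of \<open>X\<close> in the
    contraction; the second limit below is the relative variation of the flux on the tail. Both
    exponents of \<open>y\<close> are positive, so a small \<open>H a\<close> brings both below
    \<open>1/2\<close>.\<close>
  have "((\<lambda>y. T * (B * (K0 powr q * y powr (\<beta> * q) + C powr q * (y powr \<mu> / \<mu>)))) \<longlongrightarrow> T * (B * (K0 powr q * 0 + C powr q * (0 / \<mu>)))) (at_right 0)"
    using q K0 \<mu> by (intro tendsto_intros tendsto_powr_at_right_0) auto
  then have "eventually (\<lambda>y. T * (B * (K0 powr q * y powr (\<beta> * q) + C powr q * (y powr \<mu> / \<mu>))) < 1/2) (at_right 0)"
    by (rule order_tendstoD) simp
  moreover have "((\<lambda>y. lam * ((2 * T) powr (p - 1) * (K0 * y powr \<beta>))) \<longlongrightarrow> lam * ((2 * T) powr (p - 1) * (K0 * 0))) (at_right 0)"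
    using K0 by (intro tendsto_intros tendsto_powr_at_right_0) auto
  then have "eventually (\<lambda>y. lam * ((2 * T) powr (p - 1) * (K0 * y powr \<beta>)) < 1/2) (at_right 0)"
    by (rule order_tendstoD) simp
  ultimately have "eventually (\<lambda>y. T * (B * (K0 powr q * y powr (\<beta> * q) + C powr q * (y powr \<mu> / \<mu>))) < 1/2
      \<and> lam * ((2 * T) powr (p - 1) * (K0 * y powr \<beta>)) < 1/2) (at_right 0)"
    by (rule eventually_conj)
  then obtain e where e: "0 < e" and small: "\<And>y. 0 < y \<Longrightarrow> y < e \<Longrightarrow>
      T * (B * (K0 powr q * y powr (\<beta> * q) + C powr q * (y powr \<mu> / \<mu>))) < 1/2
      \<and> lam * ((2 * T) powr (p - 1) * (K0 * y powr \<beta>)) < 1/2"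
    unfolding eventually_at_right_field by auto
  obtain a' where a': "a' \<in> J" "\<xi> < a'" "H a' < e" using H_small[OF e] by blast
  define a where "a = max a' a0"
  have a: "a \<in> J" "\<xi> < a" "a0 \<le> a" "a' \<le> a" using a' K0 by (auto simp: a_def max_def)
  have Ha: "0 < H a" "H a < e" using H_pos[of a] H_antimono[of a' a] a a' by auto
  define K where "K = K0 * H a powr \<beta>"
  have K: "0 \<le> K" using K0 by (simp add: K_def)
  have Kq: "K powr q = K0 powr q * H a powr (\<beta> * q)" using K0 by (simp add: K_def powr_mult powr_powr)
  have small1: "T * (B * (K powr q + C powr q * (H a powr \<mu> / \<mu>))) \<le> 1/2"
    using small[OF Ha] Kq by simp
  have small2: "lam * ((2 * T) powr (p - 1) * K) \<le> 1/2" using small[OF Ha] by (simp add: K_def)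
  have sub: "{a..r} \<subseteq> J" if "r \<in> J" for r using subJ[OF a(1) that] .
  have Hpos: "0 < H r" if "r \<in> J" "a \<le> r" for r using H_pos[of r] that a by auto
  have contHp: "continuous_on {a..r} (\<lambda>t. H t powr (p - 1))" if r: "r \<in> J" for r
  proof (intro continuous_on_powr continuous_intros contH)
    show "\<forall>x\<in>{a..r}. H x \<noteq> 0"
    proof
      fix x assume "x \<in> {a..r}"
      then have "0 < H x" using Hpos[of x] sub[OF r] by auto
      then show "H x \<noteq> 0" by simp
    qed
  qed (use a r in auto)
  have Ubdd: "\<exists>M\<ge>0. \<forall>r\<in>J. a \<le> r \<longrightarrow> \<bar>U r\<bar> \<le> M"
  proof -
    obtain a1 where a1: "a1 \<in> J" "\<And>r. r \<in> J \<Longrightarrow> a1 \<le> r \<Longrightarrow> \<bar>U r\<bar> \<le> 1" using U_small[of 1] by auto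
    have "bounded (U ` {a..a1})" using sub[OF a1(1)]
      by (intro compact_imp_bounded compact_continuous_image continuous_on_subset[OF contU]) auto
    then obtain M where "\<forall>x\<in>U ` {a..a1}. norm x \<le> M" unfolding bounded_iff by blast
    then have M: "\<bar>U r\<bar> \<le> M" if "r \<in> {a..a1}" for r using that by simp
    have "\<bar>U r\<bar> \<le> max M 1" if "r \<in> J" "a \<le> r" for r
    proof (cases "a1 \<le> r")
      case True then show ?thesis using a1(2)[of r] that by simp
    next
      case False then show ?thesis using M[of r] that by simp
    qed
    then show ?thesis by (intro exI[of _ "max M 1"]) simp
  qed
  \<comment> \<open>The shift \<open>\<eta>\<close> makes \<open>X = sup |U| / (H + \<eta>)\<close> finite a priori; the bound obtained does not depend on it.\<close>
  have key: "\<bar>U r\<bar> \<le> 2 * T * \<bar>F a\<bar> powr q * (H r + \<eta>)" if r: "r \<in> J" "a \<le> r" and \<eta>: "0 < \<eta>" for r \<eta>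
  proof -
    obtain M where M: "0 \<le> M" "\<And>r. r \<in> J \<Longrightarrow> a \<le> r \<Longrightarrow> \<bar>U r\<bar> \<le> M" using Ubdd by auto
    define Q where "Q = (\<lambda>r. \<bar>U r\<bar> / (H r + \<eta>)) ` (J \<inter> {a..})"
    define X where "X = Sup Q"
    have bddQ: "bdd_above Q" unfolding Q_def
    proof (rule bdd_aboveI2)
      fix r assume "r \<in> J \<inter> {a..}"
      then have r: "r \<in> J" "a \<le> r" by auto
      show "\<bar>U r\<bar> / (H r + \<eta>) \<le> M / \<eta>"
        using M(2)[OF r] Hpos[OF r] \<eta> M(1) by (intro frac_le) auto
    qed
    have UX: "\<bar>U t\<bar> \<le> X * (H t + \<eta>)" if t: "t \<in> J" "a \<le> t" for t
    proof -
      have "\<bar>U t\<bar> / (H t + \<eta>) \<le> X" unfolding X_def using t by (intro cSup_upper bddQ) (auto simp: Q_def)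
      then show ?thesis using Hpos[OF t] \<eta> by (simp add: field_simps)
    qed
    have X0: "0 \<le> X"
    proof -
      have "0 \<le> \<bar>U a\<bar> / (H a + \<eta>)" using Hpos[of a] a \<eta> by auto
      also have "\<dots> \<le> X" unfolding X_def using a by (intro cSup_upper bddQ) (auto simp: Q_def)
      finally show ?thesis .
    qed
    \<comment> \<open>By homogeneity the power \<open>q\<close> of \<open>Z\<close> is linear in
      \<open>X\<close>; likewise that of \<open>\<eta> powr (p - 1)\<close> is
      \<open>\<eta>\<close>.\<close>
    define Z where "Z = lam * (X powr (p - 1) * 2 powr (p - 1))"
    have Z0: "0 \<le> Z" using lam by (simp add: Z_def)
    have Zq: "Z powr q = B * X"
    proof -
      have "Z = (lam * 2 powr (p - 1)) * X powr (p - 1)" by (simp add: Z_def)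
      then show ?thesis using lam X0 q by (simp add: powr_mult powr_powr B_def)
    qed
    have Fb: "\<bar>F t\<bar> \<le> \<bar>F a\<bar> + Z * K + Z * \<eta> powr (p - 1) * S t" if t: "t \<in> J" "a \<le> t" for t
    proof -
      note st = sub[OF t(1)]
      let ?c = "X powr (p - 1) * 2 powr (p - 1)"
      have i1: "(\<lambda>x. H x powr (p - 1) * s x) integrable_on {a..t}" by (intro integrable_mult_s st contHp t)
      have i2: "(\<lambda>x. \<eta> powr (p - 1) * s x) integrable_on {a..t}" using s(1)[OF st] by (rule integrable_on_mult_right)
      have i3: "(\<lambda>x. H x powr (p - 1) * s x + \<eta> powr (p - 1) * s x) integrable_on {a..t}" using i1 i2 by (rule integrable_add)
      have "integral {a..t} (\<lambda>r. \<bar>U r\<bar> powr (p - 1) * s r)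
          \<le> integral {a..t} (\<lambda>x. ?c * (H x powr (p - 1) * s x + \<eta> powr (p - 1) * s x))"
      proof (rule integral_le)
        show "(\<lambda>r. \<bar>U r\<bar> powr (p - 1) * s r) integrable_on {a..t}"
          by (intro integrable_mult_s st continuous_powr_abs_U)
        show "(\<lambda>x. ?c * (H x powr (p - 1) * s x + \<eta> powr (p - 1) * s x)) integrable_on {a..t}"
          using i3 by (rule integrable_on_mult_right)
        fix x assume "x \<in> {a..t}"
        then have x: "x \<in> J" "a \<le> x" using st by auto
        have "\<bar>U x\<bar> powr (p - 1) \<le> (X * (H x + \<eta>)) powr (p - 1)"
          using UX[OF x] p by (intro powr_mono2) auto
        also have "\<dots> = X powr (p - 1) * (H x + \<eta>) powr (p - 1)" using X0 Hpos[OF x] \<eta> by (simp add: powr_mult)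
        also have "\<dots> \<le> X powr (p - 1) * (2 powr (p - 1) * (H x powr (p - 1) + \<eta> powr (p - 1)))"
          using Hpos[OF x] \<eta> p by (intro mult_left_mono powr_add_le2) auto
        finally have "\<bar>U x\<bar> powr (p - 1) * s x \<le> X powr (p - 1) * (2 powr (p - 1) * (H x powr (p - 1) + \<eta> powr (p - 1))) * s x"
          using s(2) by (intro mult_right_mono) auto
        then show "\<bar>U x\<bar> powr (p - 1) * s x \<le> ?c * (H x powr (p - 1) * s x + \<eta> powr (p - 1) * s x)"
          by (simp add: algebra_simps)
      qed
      also have "\<dots> = ?c * (integral {a..t} (\<lambda>x. H x powr (p - 1) * s x) + \<eta> powr (p - 1) * integral {a..t} s)"
        unfolding integral_mult_right Henstock_Kurzweil_Integration.integral_add[OF i1 i2] ..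
      also have "\<dots> \<le> ?c * (K + \<eta> powr (p - 1) * S t)"
      proof (intro mult_left_mono add_mono)
        show "integral {a..t} (\<lambda>x. H x powr (p - 1) * s x) \<le> K" unfolding K_def using Kint a t by auto
        have "0 \<le> S a" using s_pos[of a] a by (auto simp: S_def)
        then show "integral {a..t} s \<le> S t" using S_add[of a t] a t by auto
      qed auto
      finally have "lam * integral {a..t} (\<lambda>r. \<bar>U r\<bar> powr (p - 1) * s r) \<le> lam * (?c * (K + \<eta> powr (p - 1) * S t))"
        using lam by (intro mult_left_mono) auto
      also have "\<dots> = Z * K + Z * \<eta> powr (p - 1) * S t" by (simp add: Z_def algebra_simps)
      finally show ?thesis using F_diff[OF t(2) st] by linarith
    qed
    have Fq: "\<bar>F t\<bar> powr q \<le> T * (\<bar>F a\<bar> powr q + B * X * K powr q) + T * (B * X * \<eta> * C powr q) * H t powr (\<mu> - 1)"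
      if t: "t \<in> J" "a \<le> t" for t
    proof -
      have St: "0 \<le> S t" "S t \<le> C * H t powr (- \<epsilon>)" using s_pos[of t] S_le[of t] a t by (auto simp: S_def)
      have "\<bar>F t\<bar> powr q \<le> (\<bar>F a\<bar> + Z * K + Z * \<eta> powr (p - 1) * S t) powr q"
        using Fb[OF t] q by (intro powr_mono2) auto
      also have "\<dots> \<le> T * (\<bar>F a\<bar> powr q + (Z * K) powr q + (Z * \<eta> powr (p - 1) * S t) powr q)"
        unfolding T_def using Z0 K St q by (intro powr_add_le3) auto
      also have "(Z * K) powr q = B * X * K powr q" using Z0 K Zq by (simp add: powr_mult)
      also have "(Z * \<eta> powr (p - 1) * S t) powr q = B * X * \<eta> * S t powr q"
        using Z0 \<eta> St Zq q by (simp add: powr_mult powr_powr)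
      also have "T * (\<bar>F a\<bar> powr q + B * X * K powr q + B * X * \<eta> * S t powr q)
          \<le> T * (\<bar>F a\<bar> powr q + B * X * K powr q + B * X * \<eta> * (C * H t powr (- \<epsilon>)) powr q)"
        using TB X0 \<eta> St q by (intro mult_left_mono add_mono order_refl powr_mono2) auto
      also have "(C * H t powr (- \<epsilon>)) powr q = C powr q * H t powr (\<mu> - 1)"
        using C \<mu> by (simp add: powr_mult powr_powr)
      finally show ?thesis by (simp add: algebra_simps)
    qed
    have Ur: "\<bar>U t\<bar> \<le> (T * \<bar>F a\<bar> powr q + X / 2) * (H t + \<eta>)" if t: "t \<in> J" "a \<le> t" for t
    proof -
      define W1 W2 where "W1 = T * (\<bar>F a\<bar> powr q + B * X * K powr q)" and "W2 = T * (B * X * \<eta> * C powr q)"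
      have W: "0 \<le> W1" "0 \<le> W2" using TB X0 \<eta> by (auto simp: W1_def W2_def)
      have step: "\<bar>U t\<bar> \<le> \<bar>U b\<bar> + (W1 * H t + W2 * (H a powr \<mu> / \<mu>))" if b: "b \<in> J" "t \<le> b" for b
      proof -
        have sb: "{t..b} \<subseteq> J" using sub[OF b(1)] t by auto
        have Hd: "H t - H x = integral {t..x} h" "0 < H x" if "x \<in> {t..b}" for x
          using H_diff[of t x] Hpos[of x] that t a sb by auto
        note tail = tail_integral_h[OF t(1) b(1) b(2) \<mu>(1) Hd]
        have i1: "(\<lambda>r. W1 * h r) integrable_on {t..b}" using h(1)[OF sb] by (rule integrable_on_mult_right)
        have i2: "(\<lambda>r. W2 * (H r powr (\<mu> - 1) * h r)) integrable_on {t..b}" using tail(1) by (intro integrable_on_mult_right)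
        have "\<bar>U b - U t\<bar> \<le> integral {t..b} (\<lambda>r. \<bar>F r\<bar> powr q * h r)"
          using U_diff[OF b(2) sb] by (simp add: q_def)
        also have "\<dots> \<le> integral {t..b} (\<lambda>r. W1 * h r + W2 * (H r powr (\<mu> - 1) * h r))"
        proof (rule integral_le)
          show "(\<lambda>r. \<bar>F r\<bar> powr q * h r) integrable_on {t..b}"
            unfolding q_def by (intro integrable_mult_h sb continuous_powr_abs_F)
          show "(\<lambda>r. W1 * h r + W2 * (H r powr (\<mu> - 1) * h r)) integrable_on {t..b}"
            using i1 i2 by (rule integrable_add)
          fix x assume "x \<in> {t..b}"
          then have x: "x \<in> J" "a \<le> x" using sb t by auto
          have "\<bar>F x\<bar> powr q * h x \<le> (W1 + W2 * H x powr (\<mu> - 1)) * h x"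
            unfolding W1_def W2_def using Fq[OF x] h(2) by (intro mult_right_mono) auto
          then show "\<bar>F x\<bar> powr q * h x \<le> W1 * h x + W2 * (H x powr (\<mu> - 1) * h x)" by (simp add: algebra_simps)
        qed
        also have "\<dots> = W1 * integral {t..b} h + W2 * integral {t..b} (\<lambda>r. H r powr (\<mu> - 1) * h r)"
          unfolding Henstock_Kurzweil_Integration.integral_add[OF i1 i2] integral_mult_right ..
        also have "\<dots> \<le> W1 * H t + W2 * (H a powr \<mu> / \<mu>)"
        proof (intro add_mono mult_left_mono W)
          show "integral {t..b} h \<le> H t" using Hd[of b] b by auto
          have "integral {t..b} (\<lambda>r. H r powr (\<mu> - 1) * h r) \<le> H t powr \<mu> / \<mu>" by (rule tail(2))
          also have "\<dots> \<le> H a powr \<mu> / \<mu>" using H_antimono[of a t] Hpos[OF t] a t \<mu>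
            by (intro divide_right_mono powr_mono2) auto
          finally show "integral {t..b} (\<lambda>r. H r powr (\<mu> - 1) * h r) \<le> H a powr \<mu> / \<mu>" .
        qed
        finally show ?thesis by linarith
      qed
      \<comment> \<open>The term \<open>\<bar>U b\<bar>\<close> disappears as \<open>b\<close>
        approaches the right end, which is where the decay of \<open>U\<close> enters.\<close>
      have "\<bar>U t\<bar> \<le> W1 * H t + W2 * (H a powr \<mu> / \<mu>)"
      proof (rule field_le_epsilon)
        fix e' :: real assume "0 < e'"
        then obtain b where b: "b \<in> J" "\<And>r. r \<in> J \<Longrightarrow> b \<le> r \<Longrightarrow> \<bar>U r\<bar> \<le> e'" using U_small by blast
        have m: "max b t \<in> J" "t \<le> max b t" "b \<le> max b t" using b t by (auto simp: max_def)
        show "\<bar>U t\<bar> \<le> W1 * H t + W2 * (H a powr \<mu> / \<mu>) + e'"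
          using step[OF m(1,2)] b(2)[OF m(1,3)] by linarith
      qed
      also have "\<dots> = T * \<bar>F a\<bar> powr q * H t + X * (T * (B * (K powr q * H t + C powr q * (H a powr \<mu> / \<mu>) * \<eta>)))"
        by (simp add: W1_def W2_def algebra_simps)
      \<comment> \<open>Both \<open>H t\<close> and \<open>\<eta>\<close> are at most
        \<open>H t + \<eta>\<close>; the factor \<open>\<eta>\<close> of the singular term thus
        restores the weight, and the coefficient is free of \<open>\<eta>\<close>.\<close>
      also have "\<dots> \<le> T * \<bar>F a\<bar> powr q * (H t + \<eta>) + X * (T * (B * (K powr q * (H t + \<eta>) + C powr q * (H a powr \<mu> / \<mu>) * (H t + \<eta>))))"
        using TB X0 \<eta> Hpos[OF t] \<mu> by (intro add_mono mult_left_mono) auto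
      also have "\<dots> = (T * \<bar>F a\<bar> powr q + X * (T * (B * (K powr q + C powr q * (H a powr \<mu> / \<mu>))))) * (H t + \<eta>)"
        by (simp add: algebra_simps)
      also have "\<dots> \<le> (T * \<bar>F a\<bar> powr q + X * (1/2)) * (H t + \<eta>)"
        using small1 X0 \<eta> Hpos[OF t] by (intro mult_right_mono add_mono mult_left_mono) auto
      finally show ?thesis by simp
    qed
    have "X \<le> T * \<bar>F a\<bar> powr q + X / 2"
      unfolding X_def
    proof (rule cSup_least)
      show "Q \<noteq> {}" using a by (auto simp: Q_def)
      fix x assume "x \<in> Q"
      then obtain t where t: "t \<in> J" "a \<le> t" "x = \<bar>U t\<bar> / (H t + \<eta>)" by (auto simp: Q_def)
      show "x \<le> T * \<bar>F a\<bar> powr q + Sup Q / 2"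
        using Ur[OF t(1,2)] Hpos[OF t(1,2)] \<eta> unfolding t(3) X_def by (simp add: pos_divide_le_eq)
    qed
    then have "X \<le> 2 * T * \<bar>F a\<bar> powr q" by simp
    then have "X * (H r + \<eta>) \<le> 2 * T * \<bar>F a\<bar> powr q * (H r + \<eta>)" using Hpos[OF r] \<eta> by (intro mult_right_mono) auto
    then show ?thesis using UX[OF r] by linarith
  qed
  have bound: "\<bar>U r\<bar> \<le> 2 * T * \<bar>F a\<bar> powr q * H r" if r: "r \<in> J" "a \<le> r" for r
  proof (rule field_le_epsilon)
    fix e' :: real assume e': "0 < e'"
    define A where "A = 2 * T * \<bar>F a\<bar> powr q"
    have A: "0 \<le> A" using TB by (simp add: A_def)
    \<comment> \<open>The shift is sent to 0; \<open>A + 1\<close> instead of \<open>A\<close>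
      allows \<open>A = 0\<close>.\<close>
    have "\<bar>U r\<bar> \<le> A * (H r + e' / (A + 1))" unfolding A_def using e' A by (intro key r) (auto simp: A_def)
    also have "\<dots> \<le> A * H r + e'" using A e' by (simp add: field_simps)
    finally show "\<bar>U r\<bar> \<le> 2 * T * \<bar>F a\<bar> powr q * H r + e'" by (simp add: A_def)
  qed
  have fl: "\<bar>F r - F a\<bar> \<le> \<bar>F a\<bar> / 2" if r: "r \<in> J" "a \<le> r" for r
  proof -
    note sr = sub[OF r(1)]
    let ?c = "(2 * T) powr (p - 1) * \<bar>F a\<bar>"
    have "integral {a..r} (\<lambda>r. \<bar>U r\<bar> powr (p - 1) * s r) \<le> integral {a..r} (\<lambda>x. ?c * (H x powr (p - 1) * s x))"
    proof (rule integral_le)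
      show "(\<lambda>r. \<bar>U r\<bar> powr (p - 1) * s r) integrable_on {a..r}"
        by (intro integrable_mult_s sr continuous_powr_abs_U)
      show "(\<lambda>x. ?c * (H x powr (p - 1) * s x)) integrable_on {a..r}"
        by (intro integrable_on_mult_right integrable_mult_s sr contHp r)
      fix x assume "x \<in> {a..r}"
      then have x: "x \<in> J" "a \<le> x" using sr by auto
      have "\<bar>U x\<bar> powr (p - 1) \<le> (2 * T * \<bar>F a\<bar> powr q * H x) powr (p - 1)"
        using bound[OF x] p by (intro powr_mono2) auto
      also have "\<dots> = ?c * H x powr (p - 1)"
        using TB Hpos[OF x] q by (simp add: powr_mult powr_powr)
      finally have "\<bar>U x\<bar> powr (p - 1) * s x \<le> ?c * H x powr (p - 1) * s x"
        using s(2) by (intro mult_right_mono) auto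
      then show "\<bar>U x\<bar> powr (p - 1) * s x \<le> ?c * (H x powr (p - 1) * s x)" by (simp add: mult.assoc)
    qed
    also have "\<dots> = ?c * integral {a..r} (\<lambda>x. H x powr (p - 1) * s x)" by (rule integral_mult_right)
    also have "\<dots> \<le> ?c * K" unfolding K_def using Kint[of a r] a r by (intro mult_left_mono) auto
    finally have "lam * integral {a..r} (\<lambda>r. \<bar>U r\<bar> powr (p - 1) * s r) \<le> lam * (?c * K)"
      using lam by (intro mult_left_mono) auto
    also have "\<dots> = (lam * ((2 * T) powr (p - 1) * K)) * \<bar>F a\<bar>" by (simp add: mult_ac)
    also have "\<dots> \<le> 1/2 * \<bar>F a\<bar>" using small2 by (intro mult_right_mono) auto
    finally show ?thesis using F_diff[OF r(2) sr] by simp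
  qed
  show ?thesis
    using that[OF a(1,2) _ fl] bound unfolding q_def by blast
qed

lemma flux_nonvanishing:
  assumes nt: "r0 \<in> J" "U r0 \<noteq> 0"
  obtains a where "a \<in> J" "\<xi> < a" "F a \<noteq> 0" "\<And>r. r \<in> J \<Longrightarrow> a \<le> r \<Longrightarrow> \<bar>F r - F a\<bar> \<le> \<bar>F a\<bar> / 2"
proof -
  obtain a c where a: "a \<in> J" "\<xi> < a"
    "\<And>r. r \<in> J \<Longrightarrow> a \<le> r \<Longrightarrow> \<bar>U r\<bar> \<le> c * \<bar>F a\<bar> powr (1 / (p - 1)) * H r"
    "\<And>r. r \<in> J \<Longrightarrow> a \<le> r \<Longrightarrow> \<bar>F r - F a\<bar> \<le> \<bar>F a\<bar> / 2"
    by (rule flux_controlled) (rule that; assumption)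
  have "F a \<noteq> 0"
  proof
    assume "F a = 0"
    with a(3)[OF a(1)] have "U a = 0" by simp
    from zero_globally[OF a(1) this \<open>F a = 0\<close> nt(1)] nt(2) show False by simp
  qed
  with a that show ?thesis by blast
qed

end

section \<open>Behaviour at the right end point\<close>

text \<open>A vanishing integral would make \<open>g\<close> zero a.e. on an interval where it is
  positive a.e., so the interval would be a null set.\<close>

lemma integral_pos_of_AE_pos:
  fixes g :: "real \<Rightarrow> real"
  assumes ab: "a < b" and g: "g absolutely_integrable_on {a..b}"
    and pos: "AE r in lebesgue. r \<in> {a..b} \<longrightarrow> 0 < g r"
  shows "0 < integral {a..b} g"
proof -
  have eq: "integral {a..b} g = (LINT r|lebesgue. indicator {a..b} r *\<^sub>R g r)"
    using set_lebesgue_integral_eq_integral(2)[OF g] by (simp add: set_lebesgue_integral_def)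
  have nn: "AE r in lebesgue. 0 \<le> indicator {a..b} r *\<^sub>R g r"
    using pos by eventually_elim (auto simp: indicator_def)
  have "0 \<le> integral {a..b} g" unfolding eq using nn by (rule integral_nonneg_AE)
  moreover have "integral {a..b} g \<noteq> 0"
  proof
    assume "integral {a..b} g = 0"
    then have "AE r in lebesgue. indicator {a..b} r *\<^sub>R g r = 0"
      unfolding eq using integral_nonneg_eq_0_iff_AE[OF g[unfolded set_integrable_def] nn] by simp
    then have "AE r in lebesgue. r \<notin> {a..b}" using pos by eventually_elim (auto simp: indicator_def)
    then obtain N where "negligible N" "{r. \<not> r \<notin> {a..b}} \<subseteq> N"
      unfolding eventually_ae_filter_negligible by blast
    then have "negligible {a..b}" by (elim negligible_subset) auto
    then show False using ab negligible_interval(1)[of a b] by auto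
  qed
  ultimately show ?thesis by simp
qed

text \<open>Dominated convergence along a sequence that tends to \<open>R2\<close> in the extended
  reals, which covers an infinite end point as well.\<close>

lemma tail_tendsto_zero:
  fixes h :: "real \<Rightarrow> real"
  assumes \<xi>: "ereal \<xi> < R2" and h: "set_integrable lebesgue (ivl \<xi> R2) h" and e: "0 < e"
  shows "\<exists>a\<in>ivl \<xi> R2. (LINT r:ivl a R2|lebesgue. h r) < e"
proof -
  obtain X :: "nat \<Rightarrow> real" where X: "\<And>i. ereal \<xi> < X i" "\<And>i. X i < R2" "(\<lambda>i. ereal (X i)) \<longlonglongrightarrow> R2"
    using ereal_incseq_approx[OF \<xi>] by metis
  have "(\<lambda>i. LINT r|lebesgue. indicator (ivl (X i) R2) r *\<^sub>R h r) \<longlonglongrightarrow> (LINT r|(lebesgue :: real measure). 0)"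
  proof (rule integral_dominated_convergence[where w = "\<lambda>r. norm (indicator (ivl \<xi> R2) r *\<^sub>R h r)"])
    have sub: "ivl (X i) R2 \<subseteq> ivl \<xi> R2" for i using X(1)[of i] by (auto simp: ivl_def)
    show "(\<lambda>r. indicator (ivl (X i) R2) r *\<^sub>R h r) \<in> borel_measurable lebesgue" for i
      using set_integrable_subset[OF h _ sub[of i]] open_ivl[of "X i" R2]
      by (auto simp: set_integrable_def intro: borel_measurable_integrable)
    show "integrable lebesgue (\<lambda>r. norm (indicator (ivl \<xi> R2) r *\<^sub>R h r))"
      using h unfolding set_integrable_def by (rule integrable_norm)
    show "AE r in lebesgue. norm (indicator (ivl (X i) R2) r *\<^sub>R h r) \<le> norm (indicator (ivl \<xi> R2) r *\<^sub>R h r)" for i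
      using sub[of i] by (intro always_eventually allI) (auto simp: indicator_def)
    show "AE r in lebesgue. (\<lambda>i. indicator (ivl (X i) R2) r *\<^sub>R h r) \<longlonglongrightarrow> 0"
    proof (intro always_eventually allI)
      fix r
      show "(\<lambda>i. indicator (ivl (X i) R2) r *\<^sub>R h r) \<longlonglongrightarrow> 0"
      proof (cases "ereal r < R2")
        case True
        have "\<forall>\<^sub>F i in sequentially. ereal r < ereal (X i)" using X(3) True by (rule order_tendstoD)
        then have "\<forall>\<^sub>F i in sequentially. indicator (ivl (X i) R2) r *\<^sub>R h r = 0"
          by eventually_elim (auto simp: ivl_def)
        then show ?thesis by (rule tendsto_eventually)
      next
        case False
        then show ?thesis by (simp add: ivl_def)
      qed
    qed
  qed simp
  then have "(\<lambda>i. LINT r:ivl (X i) R2|lebesgue. h r) \<longlonglongrightarrow> 0" by (simp add: set_lebesgue_integral_def)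
  then have "\<forall>\<^sub>F i in sequentially. (LINT r:ivl (X i) R2|lebesgue. h r) < e" using e by (rule order_tendstoD)
  then obtain i where "(LINT r:ivl (X i) R2|lebesgue. h r) < e" by (auto simp: eventually_sequentially)
  moreover have "X i \<in> ivl \<xi> R2" using X(1,2)[of i] by (auto simp: ivl_def)
  ultimately show ?thesis by blast
qed

lemma tail_diff:
  fixes h :: "real \<Rightarrow> real"
  assumes h: "set_integrable lebesgue (ivl \<xi> R2) h" and ab: "\<xi> \<le> a" "a \<le> b" "ereal b < R2"
  shows "(LINT r:ivl a R2|lebesgue. h r) - (LINT r:ivl b R2|lebesgue. h r) = integral {a..b} h"
proof -
  have un: "ivl a R2 = {a<..b} \<union> ivl b R2"
    using ab(2,3) by (auto simp: ivl_def intro: le_less_trans[of _ "ereal b"])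
  have s1: "{a<..b} \<subseteq> ivl \<xi> R2" "ivl b R2 \<subseteq> ivl \<xi> R2"
    using ab by (auto simp: ivl_def intro: le_less_trans[of _ "ereal b"])
  have i1: "set_integrable lebesgue {a<..b} h" "set_integrable lebesgue (ivl b R2) h"
    using s1 open_ivl[of b R2] by (auto intro: set_integrable_subset[OF h])
  have "(LINT r:ivl a R2|lebesgue. h r) = (LINT r:{a<..b}|lebesgue. h r) + (LINT r:ivl b R2|lebesgue. h r)"
    unfolding un by (rule set_integral_Un[OF _ i1]) (auto simp: ivl_def)
  moreover have "(LINT r:{a<..b}|lebesgue. h r) = integral {a<..b} h" using i1(1) by (rule set_lebesgue_integral_eq_integral)
  moreover have "integral {a<..b} h = integral {a..b} h"
    by (rule integral_spike_set) (auto intro: negligible_subset[of "{a}"])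
  ultimately show ?thesis by simp
qed

text \<open>Brings both cases of \<open>upper_filter\<close> into the form without end point that
  \<open>half_linear_tail\<close> asks for.\<close>

lemma upper_filter_small:
  fixes U :: "real \<Rightarrow> real"
  assumes R: "ereal R1 < R2" and lim: "(U \<longlongrightarrow> 0) (upper_filter R2)" and e: "0 < e"
  shows "\<exists>a\<in>ivl R1 R2. \<forall>r\<in>ivl R1 R2. a \<le> r \<longrightarrow> \<bar>U r\<bar> \<le> e"
proof -
  have ev: "\<forall>\<^sub>F r in upper_filter R2. \<bar>U r\<bar> < e" using tendstoD[OF lim e] by (simp add: dist_real_def)
  show ?thesis
  proof (cases R2)
    case (real x)
    then have "\<forall>\<^sub>F r in at_left x. \<bar>U r\<bar> < e" using ev by (simp add: upper_filter_def)
    then obtain b where b: "b < x" "\<And>y. b < y \<Longrightarrow> y < x \<Longrightarrow> \<bar>U y\<bar> < e" unfolding eventually_at_left_field by blast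
    have "max b R1 < x" using b R real by simp
    then obtain a where a: "max b R1 < a" "a < x" using dense by blast
    show ?thesis
    proof (intro bexI ballI impI)
      show "a \<in> ivl R1 R2" using a real by (auto simp: ivl_def)
      fix r assume "r \<in> ivl R1 R2" "a \<le> r"
      then show "\<bar>U r\<bar> \<le> e" using b(2)[of r] a real by (auto simp: ivl_def)
    qed
  next
    case PInf
    then have "\<forall>\<^sub>F r in at_top. \<bar>U r\<bar> < e" using ev by (simp add: upper_filter_def)
    then obtain b where b: "\<And>y. b \<le> y \<Longrightarrow> \<bar>U y\<bar> < e" unfolding eventually_at_top_linorder by blast
    show ?thesis
    proof (intro bexI ballI impI)
      show "max b (R1 + 1) \<in> ivl R1 R2" using PInf by (auto simp: ivl_def)
      fix r assume "r \<in> ivl R1 R2" "max b (R1 + 1) \<le> r"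
      then show "\<bar>U r\<bar> \<le> e" using b[of r] by auto
    qed
  next
    case MInf
    then show ?thesis using R by simp
  qed
qed

text \<open>The set where \<open>v\<close> is negative is open and null, hence empty. Zeros of
  \<open>v\<close> are not excluded.\<close>

lemma nonneg_of_continuous_AE_pos:
  fixes v :: "real \<Rightarrow> real"
  assumes J: "open J" and v: "continuous_on J v" and pos: "AE r in lebesgue. r \<in> J \<longrightarrow> 0 < v r" and r: "r \<in> J"
  shows "0 \<le> v r"
proof (rule ccontr)
  assume "\<not> 0 \<le> v r"
  then have r': "r \<in> {r \<in> J. v r < 0}" using r by simp
  have "open (J \<inter> v -` {..<0})" using v J by (intro continuous_open_preimage) auto
  moreover have "J \<inter> v -` {..<0} = {r \<in> J. v r < 0}" by auto
  ultimately have op: "open {r \<in> J. v r < 0}" by simp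
  obtain N where "negligible N" "{r. \<not> (r \<in> J \<longrightarrow> 0 < v r)} \<subseteq> N"
    using pos unfolding eventually_ae_filter_negligible by blast
  then have "negligible {r \<in> J. v r < 0}" by (elim negligible_subset) auto
  with open_not_negligible[OF op] r' show False by blast
qed

section \<open>Asymptotics of radial solutions\<close>

theorem theorem1p11:
  fixes p lam R1 :: real and R2 :: ereal and v w U :: "real \<Rightarrow> real"
    and u :: "real^'n \<Rightarrow> real"
  assumes N2: "CARD('n) \<ge> 2"
    and p: "1 < p"
    and R: "0 < R1" "ereal R1 < R2"
    and W: "cond_W p R1 R2 v w"
    and A: "cond_A CARD('n) p R1 R2 v w"
    and lam: "lam > 0"
    and radial: "\<forall>x \<in> annulus R1 R2. u x = U (norm x)"
    and nontriv: "\<exists>x \<in> annulus R1 R2. u x \<noteq> 0"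
    and sol: "weak_solution p v w lam (annulus R1 R2) u"
    and C1: "C1_on (annulus R1 R2) u"
    and lim1: "(U \<longlongrightarrow> 0) (at_right R1)"
    and lim2: "(U \<longlongrightarrow> 0) (upper_filter R2)"
  shows "\<exists>b C1 C2 D1 D2. R1 < b \<and> ereal b < R2 \<and>
           0 < C1 \<and> C1 < C2 \<and> 0 < D1 \<and> D1 < D2 \<and>
           (\<forall>r \<in> ivl b R2.
              C1 * set_lebesgue_integral lebesgue (ivl r R2)
                     (\<lambda>\<tau>. rho CARD('n) v \<tau> powr (1 - p / (p - 1))) \<le> \<bar>U r\<bar> \<and>
              \<bar>U r\<bar> \<le> C2 * set_lebesgue_integral lebesgue (ivl r R2)
                     (\<lambda>\<tau>. rho CARD('n) v \<tau> powr (1 - p / (p - 1))) \<and>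
              D1 * rho CARD('n) v r powr (1 - p / (p - 1)) \<le> \<bar>deriv U r\<bar> \<and>
              \<bar>deriv U r\<bar> \<le> D2 * rho CARD('n) v r powr (1 - p / (p - 1)))"
proof -
  \<comment> \<open>The exponent \<open>1 - p'\<close> of the statement is \<open>- q\<close>, so
    \<open>h\<close> below is \<open>\<rho> powr (- q)\<close>.\<close>
  define q where "q = 1 / (p - 1)"
  have q: "0 < q" "(p - 1) * q = 1" "1 - p / (p - 1) = - q" "- 1 / (p - 1) = - q"
    using p by (auto simp: q_def field_simps)
  let ?J = "ivl R1 R2"
  define \<rho> \<sigma> where "\<rho> = rho CARD('n) v" and "\<sigma> = sigma CARD('n) w"
  define h where "h r = \<rho> r powr (1 - p / (p - 1))" for r
  define H where "H r = (LINT t:ivl r R2|lebesgue. h t)" for r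
  define F where "F r = \<rho> r * (\<bar>deriv U r\<bar> powr (p - 2) * deriv U r)" for r
  have radial': "\<And>x. x \<in> annulus R1 R2 \<Longrightarrow> u x = U (norm x)" using radial by blast
  have DU: "(U has_real_derivative deriv U r) (at r)" if "r \<in> ?J" for r
    by (rule radial_profile(1)[OF R(1) radial' C1 that])
  have contU': "continuous_on ?J (deriv U)" by (rule radial_profile(2)[OF R(1) radial' C1])
  have contU: "continuous_on ?J U" using DU by (intro DERIV_continuous_on) (auto intro: has_field_derivative_at_within)
  have vpos: "AE r in lebesgue. r \<in> ?J \<longrightarrow> 0 < v r" and wpos: "AE r in lebesgue. r \<in> ?J \<longrightarrow> 0 < w r"
    and contv: "continuous_on ?J v" and wmeas: "set_borel_measurable lebesgue ?J w"
    and vint: "\<And>a b. {a..b} \<subseteq> ?J \<Longrightarrow> (\<lambda>r. v r powr (- q)) absolutely_integrable_on {a..b}"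
    and wint: "\<And>a b. {a..b} \<subseteq> ?J \<Longrightarrow> w absolutely_integrable_on {a..b}"
    using W unfolding cond_W_def q(4) by blast+
  have v0: "0 \<le> v r" if "r \<in> ?J" for r by (rule nonneg_of_continuous_AE_pos[OF open_ivl contv vpos that])
  have rpos: "0 < r" if "r \<in> ?J" for r using that R by (auto simp: ivl_def)
  have \<rho>0: "0 \<le> \<rho> r" if "r \<in> ?J" for r using v0[OF that] rpos[OF that] by (simp add: \<rho>_def rho_def)
  have habs: "h absolutely_integrable_on {a..b}" if "{a..b} \<subseteq> ?J" for a b
  proof -
    have J: "r \<in> ?J" if "r \<in> {a..b}" for r using that \<open>{a..b} \<subseteq> ?J\<close> by blast
    have c: "continuous_on {a..b} (\<lambda>r. (r ^ (CARD('n) - 1)) powr (- q))"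
    proof (intro continuous_intros ballI)
      fix r assume "r \<in> {a..b}"
      then show "r ^ (CARD('n) - 1) \<noteq> 0" using rpos[OF J] by force
    qed
    have i: "(\<lambda>r. (r ^ (CARD('n) - 1)) powr (- q) * v r powr (- q)) absolutely_integrable_on {a..b}"
      by (rule absolutely_integrable_continuous_mult[OF c vint[OF that]])
    have eq: "(r ^ (CARD('n) - 1)) powr (- q) * v r powr (- q) = h r" if "r \<in> {a..b}" for r
      using rpos[OF J[OF that]] v0[OF J[OF that]] by (simp add: h_def \<rho>_def rho_def q(3) powr_mult)
    show ?thesis by (rule iffD1[OF set_integrable_cong[OF refl refl eq] i])
  qed
  have \<sigma>abs: "\<sigma> absolutely_integrable_on {a..b}" if "{a..b} \<subseteq> ?J" for a b
    unfolding \<sigma>_def sigma_def[abs_def]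
    by (intro absolutely_integrable_continuous_mult wint that continuous_intros)
  have \<sigma>pos: "AE r in lebesgue. r \<in> ?J \<longrightarrow> 0 < \<sigma> r"
    using wpos by eventually_elim (use rpos in \<open>auto simp: \<sigma>_def sigma_def\<close>)
  have hpos: "AE r in lebesgue. r \<in> ?J \<longrightarrow> 0 < h r"
    using vpos by eventually_elim (use rpos in \<open>force simp: h_def \<rho>_def rho_def\<close>)
  have cont\<rho>: "continuous_on ?J \<rho>" unfolding \<rho>_def rho_def[abs_def] by (intro continuous_intros contv)
  have contF: "continuous_on ?J F"
    unfolding F_def using continuous_on_compose2[OF continuous_signed_powr[OF p] contU']
    by (intro continuous_on_mult[OF cont\<rho>]) simp
  \<comment> \<open>The definition of the flux solved for \<open>\<bar>deriv U r\<bar>\<close>.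
    Where \<open>\<rho> r = 0\<close> the right side is 0 whatever the derivative is, hence the
    premise.\<close>
  have U'F: "\<bar>deriv U r\<bar> = \<bar>F r\<bar> powr q * h r" if "0 < \<rho> r" for r
  proof -
    have "\<bar>F r\<bar> = \<rho> r * \<bar>deriv U r\<bar> powr (p - 1)" using that abs_signed_powr[of "deriv U r" p] by (simp add: F_def abs_mult)
    then show ?thesis using that q by (simp add: powr_mult powr_powr h_def powr_minus)
  qed
  have kabs: "(\<lambda>r. lam * (\<bar>U r\<bar> powr (p - 2) * U r * \<sigma> r)) absolutely_integrable_on {a..b}"
    if sub: "{a..b} \<subseteq> ?J" for a b
  proof -
    have "continuous_on {a..b} (\<lambda>r. lam * (\<bar>U r\<bar> powr (p - 2) * U r))"
      using continuous_on_compose2[OF continuous_signed_powr[OF p] continuous_on_subset[OF contU sub]]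
      by (intro continuous_on_mult_left) simp
    from absolutely_integrable_continuous_mult[OF this \<sigma>abs[OF sub]] show ?thesis by (simp add: mult.assoc)
  qed
  have Feq: "F b - F a = - integral {a..b} (\<lambda>r. lam * (\<bar>U r\<bar> powr (p - 2) * U r * \<sigma> r))"
    if ab: "a \<le> b" "a \<in> ?J" "b \<in> ?J" for a b
  proof (rule integrated_weak_equation[OF open_ivl is_interval_ivl contF _ _ ab])
    show "(\<lambda>r. lam * (\<bar>U r\<bar> powr (p - 2) * U r * \<sigma> r)) absolutely_integrable_on {a..b}" if "{a..b} \<subseteq> ?J" for a b
      by (rule kabs[OF that])
  next
    fix \<psi> \<psi>' :: "real \<Rightarrow> real" and c d
    assume *: "{c..d} \<subseteq> ?J" "\<And>r. (\<psi> has_real_derivative \<psi>' r) (at r)" "continuous_on UNIV \<psi>'"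
      "\<And>r. r \<notin> {c<..<d} \<Longrightarrow> \<psi> r = 0 \<and> \<psi>' r = 0"
    show "(LINT r:?J|lebesgue. F r * \<psi>' r) = (LINT r:?J|lebesgue. lam * (\<bar>U r\<bar> powr (p - 2) * U r * \<sigma> r) * \<psi> r)"
      unfolding F_def \<rho>_def \<sigma>_def by (rule weak_radial_equation[OF R(1) p radial' C1 contv wmeas sol *])
  qed
  obtain \<xi> \<epsilon> C where \<xi>: "R1 < \<xi>" "ereal \<xi> < R2" and hint: "set_integrable lebesgue (ivl \<xi> R2) h"
    and \<epsilon>: "0 < \<epsilon>" "\<epsilon> < p - 1" "0 < C"
    and growth: "\<And>r. r \<in> ivl \<xi> R2 \<Longrightarrow> (LINT t:{\<xi>..r}|lebesgue. \<sigma> t) * H r powr \<epsilon> < C"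
    using A unfolding cond_A_def \<rho>_def[symmetric] \<sigma>_def[symmetric] h_def[symmetric] H_def[symmetric] by blast
  have \<xi>J: "\<xi> \<in> ?J" using \<xi> by (simp add: ivl_def)
  have subJ: "{a..b} \<subseteq> ?J" if "a \<in> ?J" "b \<in> ?J" for a b
    using is_interval_ivl[of R1 R2] that unfolding is_interval_1 by (meson atLeastAtMost_iff subsetI)
  have hI: "h integrable_on {a..b}" if "{a..b} \<subseteq> ?J" for a b using habs[OF that] absolutely_integrable_on_def by blast
  have h0: "0 \<le> h r" for r by (simp add: h_def)
  have Hdiff: "H a - H b = integral {a..b} h" if "\<xi> \<le> a" "a \<le> b" "b \<in> ?J" for a b
    unfolding H_def using that by (intro tail_diff[OF hint]) (auto simp: ivl_def)
  have H0: "0 \<le> H r" for r unfolding H_def set_lebesgue_integral_def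
    by (intro integral_nonneg_AE always_eventually) (simp add: h0)
  have Hpos: "0 < H r" if r: "r \<in> ?J" "\<xi> \<le> r" for r
  proof -
    have "ereal r < R2" using r by (simp add: ivl_def)
    then obtain b where b: "ereal r < ereal b" "ereal b < R2" using ereal_dense2 by blast
    then have bJ: "b \<in> ?J" "r < b" using r by (auto simp: ivl_def)
    have sub: "{r..b} \<subseteq> ?J" by (rule subJ[OF r(1) bJ(1)])
    have "0 < integral {r..b} h"
    proof (rule integral_pos_of_AE_pos[OF bJ(2) habs[OF sub]])
      show "AE t in lebesgue. t \<in> {r..b} \<longrightarrow> 0 < h t" using hpos by eventually_elim (use sub in blast)
    qed
    then show ?thesis using Hdiff[of r b] H0[of b] r bJ by simp
  qed
  have U_small: "\<exists>a\<in>?J. \<forall>r\<in>?J. a \<le> r \<longrightarrow> \<bar>U r\<bar> \<le> e" if "0 < e" for e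
    by (rule upper_filter_small[OF R(2) lim2 that])
  have H_small: "\<exists>a\<in>?J. \<xi> < a \<and> H a < e" if e: "0 < e" for e
  proof -
    obtain a where a: "a \<in> ivl \<xi> R2" "H a < e" using tail_tendsto_zero[OF \<xi>(2) hint e] unfolding H_def by blast
    then have "a \<in> ?J" "\<xi> < a" using \<xi> by (auto simp: ivl_def)
    then show ?thesis using a by blast
  qed
  obtain Z where Z: "negligible Z" "{r. \<not> (r \<in> ?J \<longrightarrow> 0 < v r)} \<subseteq> Z"
    using vpos unfolding eventually_ae_filter_negligible by blast
  have \<sigma>s: "integral {a..b} (\<lambda>r. \<bar>\<sigma> r\<bar>) = integral {a..b} \<sigma>" if sub: "{a..b} \<subseteq> ?J" for a b
  proof -
    obtain Y where Y: "negligible Y" "{r. \<not> (r \<in> ?J \<longrightarrow> 0 < \<sigma> r)} \<subseteq> Y"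
      using \<sigma>pos unfolding eventually_ae_filter_negligible by blast
    show ?thesis
    proof (rule integral_spike[OF Y(1)])
      fix r assume "r \<in> {a..b} - Y"
      then have "0 < \<sigma> r" using Y(2) sub by blast
      then show "\<sigma> r = \<bar>\<sigma> r\<bar>" by simp
    qed
  qed
  have absU': "\<bar>U b - U a\<bar> \<le> integral {a..b} (\<lambda>r. \<bar>deriv U r\<bar>)" "(deriv U has_integral (U b - U a)) {a..b}"
    "(\<lambda>r. \<bar>deriv U r\<bar>) integrable_on {a..b}"
    if ab: "a \<le> b" "{a..b} \<subseteq> ?J" for a b
  proof -
    show *: "(deriv U has_integral (U b - U a)) {a..b}"
    proof (rule fundamental_theorem_of_calculus[OF ab(1)])
      fix r assume "r \<in> {a..b}"
      then have "(U has_real_derivative deriv U r) (at r)" using ab(2) by (intro DU) blast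
      then show "(U has_vector_derivative deriv U r) (at r within {a..b})"
        unfolding has_real_derivative_iff_has_vector_derivative[symmetric] by (rule has_field_derivative_at_within)
    qed
    show i: "(\<lambda>r. \<bar>deriv U r\<bar>) integrable_on {a..b}"
      using contU' ab(2) by (intro integrable_continuous_real continuous_intros) (rule continuous_on_subset)
    have "norm (integral {a..b} (deriv U)) \<le> integral {a..b} (\<lambda>r. \<bar>deriv U r\<bar>)"
      using * i by (intro Henstock_Kurzweil_Integration.integral_norm_bound_integral) auto
    then show "\<bar>U b - U a\<bar> \<le> integral {a..b} (\<lambda>r. \<bar>deriv U r\<bar>)" using integral_unique[OF *] by simp
  qed
  interpret half_linear_tail p lam ?J h "\<lambda>r. \<bar>\<sigma> r\<bar>" U F \<xi> \<epsilon> C H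
  proof
    show "(\<lambda>r. \<bar>\<sigma> r\<bar>) integrable_on {a..b}" if "{a..b} \<subseteq> ?J" for a b
      using \<sigma>abs[OF that] by (simp add: absolutely_integrable_on_def)
    fix a b assume ab: "a \<le> b" "{a..b} \<subseteq> ?J"
    have "integral {a..b} (\<lambda>r. \<bar>deriv U r\<bar>) = integral {a..b} (\<lambda>r. \<bar>F r\<bar> powr (1 / (p - 1)) * h r)"
    proof (rule integral_spike[OF Z(1)])
      fix r assume r: "r \<in> {a..b} - Z"
      then have rJ: "r \<in> ?J" "0 < v r" using ab(2) Z(2) by blast+
      then have "0 < \<rho> r" using rpos by (simp add: \<rho>_def rho_def)
      then show "\<bar>F r\<bar> powr (1 / (p - 1)) * h r = \<bar>deriv U r\<bar>" using U'F by (simp add: q_def)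
    qed
    then show "\<bar>U b - U a\<bar> \<le> integral {a..b} (\<lambda>r. \<bar>F r\<bar> powr (1 / (p - 1)) * h r)" using absU'(1)[OF ab] by simp
    have abJ: "a \<in> ?J" "b \<in> ?J" using ab by auto
    have "norm (integral {a..b} (\<lambda>r. lam * (\<bar>U r\<bar> powr (p - 2) * U r * \<sigma> r)))
        \<le> integral {a..b} (\<lambda>r. norm (lam * (\<bar>U r\<bar> powr (p - 2) * U r * \<sigma> r)))"
      using kabs[OF ab(2)] unfolding absolutely_integrable_on_def
      by (intro Henstock_Kurzweil_Integration.integral_norm_bound_integral) auto
    also have "(\<lambda>r. norm (lam * (\<bar>U r\<bar> powr (p - 2) * U r * \<sigma> r))) = (\<lambda>r. lam * (\<bar>U r\<bar> powr (p - 1) * \<bar>\<sigma> r\<bar>))"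
      using lam abs_signed_powr[of _ p] by (simp add: abs_mult)
    also have "integral {a..b} \<dots> = lam * integral {a..b} (\<lambda>r. \<bar>U r\<bar> powr (p - 1) * \<bar>\<sigma> r\<bar>)"
      by (rule integral_mult_right)
    finally show "\<bar>F b - F a\<bar> \<le> lam * integral {a..b} (\<lambda>r. \<bar>U r\<bar> powr (p - 1) * \<bar>\<sigma> r\<bar>)"
      using Feq[OF ab(1) abJ] by simp
  next
    fix r assume r: "r \<in> ?J" "\<xi> < r"
    have sub: "{\<xi>..r} \<subseteq> ?J" by (rule subJ[OF \<xi>J r(1)])
    have "0 < integral {\<xi>..r} \<sigma>"
    proof (rule integral_pos_of_AE_pos[OF r(2) \<sigma>abs[OF sub]])
      show "AE t in lebesgue. t \<in> {\<xi>..r} \<longrightarrow> 0 < \<sigma> t" using \<sigma>pos by eventually_elim (use sub in blast)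
    qed
    then show "0 < integral {\<xi>..r} (\<lambda>r. \<bar>\<sigma> r\<bar>)" using \<sigma>s[OF sub] by simp
    have "(LINT t:{\<xi>..r}|lebesgue. \<sigma> t) = integral {\<xi>..r} \<sigma>" by (rule set_lebesgue_integral_eq_integral(2)[OF \<sigma>abs[OF sub]])
    then show "integral {\<xi>..r} (\<lambda>r. \<bar>\<sigma> r\<bar>) * H r powr \<epsilon> \<le> C"
      using growth[of r] r \<sigma>s[OF sub] by (simp add: ivl_def)
  qed (use p lam open_ivl is_interval_ivl hI h0 contU contF \<xi>J \<epsilon> Hdiff Hpos H_small U_small in \<open>auto\<close>)

  \<comment> \<open>From the flux to the two-sided estimates\<close>
  obtain x0 where x0: "x0 \<in> annulus R1 R2" "u x0 \<noteq> 0" using nontriv by blast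
  then have nt: "norm x0 \<in> ?J" "U (norm x0) \<noteq> 0" using radial by (auto simp: annulus_vimage)
  obtain a where a: "a \<in> ?J" "\<xi> < a" "F a \<noteq> 0" and Fa: "\<And>r. r \<in> ?J \<Longrightarrow> a \<le> r \<Longrightarrow> \<bar>F r - F a\<bar> \<le> \<bar>F a\<bar> / 2"
    using flux_nonvanishing[OF nt] by metis
  \<comment> \<open>On the tail \<open>\<bar>F\<bar>\<close> stays between one half and three halves
    of \<open>\<bar>F a\<bar>\<close>. The same pair serves for \<open>U\<close> and for its
    derivative.\<close>
  define c1 c2 where "c1 = (\<bar>F a\<bar> / 2) powr q" and "c2 = (3 * \<bar>F a\<bar> / 2) powr q"
  have c: "0 < c1" "c1 < c2" using a(3) q by (auto simp: c1_def c2_def intro!: powr_less_mono2)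
  have pt: "c1 * h r \<le> \<bar>deriv U r\<bar>" "\<bar>deriv U r\<bar> \<le> c2 * h r" "sgn (deriv U r) = sgn (F a)" if r: "r \<in> ?J" "a \<le> r" for r
  proof -
    have b: "\<bar>F a\<bar> / 2 \<le> \<bar>F r\<bar>" "\<bar>F r\<bar> \<le> 3 * \<bar>F a\<bar> / 2" using Fa[OF r] by linarith+
    then have "F r \<noteq> 0" using a(3) by auto
    \<comment> \<open>A zero of \<open>\<rho>\<close> would be a zero of the flux. So
      \<open>U'F\<close> applies at every point of the tail, with no exceptional null set.\<close>
    then have "0 < \<rho> r" using \<rho>0[OF r(1)] by (cases "\<rho> r = 0") (auto simp: F_def)
    note U'F[OF this]
    moreover have "c1 \<le> \<bar>F r\<bar> powr q" "\<bar>F r\<bar> powr q \<le> c2" using b q by (auto simp: c1_def c2_def intro!: powr_mono2)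
    ultimately show "c1 * h r \<le> \<bar>deriv U r\<bar>" "\<bar>deriv U r\<bar> \<le> c2 * h r" using h0[of r] by (auto intro: mult_right_mono)
    have "sgn (F r) = sgn (F a)" using Fa[OF r] a(3) unfolding sgn_if by (cases "0 < F a") (auto simp: abs_if split: if_splits)
    moreover have "sgn (F r) = sgn (deriv U r)"
      using \<open>0 < \<rho> r\<close> by (cases "deriv U r = 0") (simp_all add: F_def sgn_mult)
    ultimately show "sgn (deriv U r) = sgn (F a)" by simp
  qed
  have inc: "c1 * (H r - H t) \<le> \<bar>U t - U r\<bar>" "\<bar>U t - U r\<bar> \<le> c2 * (H r - H t)"
    if r: "r \<in> ?J" "a \<le> r" and t: "t \<in> ?J" "r \<le> t" for r t
  proof -
    have sub: "{r..t} \<subseteq> ?J" by (rule subJ[OF r(1) t(1)])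
    have Hrt: "H r - H t = integral {r..t} h" using Hdiff[of r t] r t a by simp
    note U' = absU'[OF t(2) sub]
    have pt': "c1 * h x \<le> \<bar>deriv U x\<bar>" "\<bar>deriv U x\<bar> \<le> c2 * h x" "sgn (deriv U x) = sgn (F a)" if "x \<in> {r..t}" for x
      using pt[of x] that sub r by auto
    have ih: "(\<lambda>x. y * h x) integrable_on {r..t}" for y using hI[OF sub] by (rule integrable_on_mult_right)
    have "\<bar>U t - U r\<bar> \<le> integral {r..t} (\<lambda>x. c2 * h x)"
      using U'(1) integral_le[OF U'(3) ih pt'(2)] by simp
    then show "\<bar>U t - U r\<bar> \<le> c2 * (H r - H t)" unfolding Hrt by simp
    \<comment> \<open>The derivative keeps the sign of \<open>F a\<close>, so nothing cancels in the
      increment of \<open>U\<close>; the lower bound rests on this.\<close>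
    have eq: "\<bar>deriv U x\<bar> = sgn (F a) * deriv U x" if "x \<in> {r..t}" for x
      using pt'(3)[OF that] by (metis mult_sgn_abs abs_sgn mult.commute)
    have "c1 * (H r - H t) = integral {r..t} (\<lambda>x. c1 * h x)" unfolding Hrt by simp
    also have "\<dots> \<le> integral {r..t} (\<lambda>x. \<bar>deriv U x\<bar>)" by (rule integral_le[OF ih U'(3) pt'(1)])
    also have "\<dots> = integral {r..t} (\<lambda>x. sgn (F a) * deriv U x)" by (rule Henstock_Kurzweil_Integration.integral_cong) (rule eq)
    also have "\<dots> = sgn (F a) * (U t - U r)" using integral_unique[OF U'(2)] by simp
    also have "\<dots> \<le> \<bar>U t - U r\<bar>" by (auto simp: sgn_if)
    finally show "c1 * (H r - H t) \<le> \<bar>U t - U r\<bar>" .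
  qed
  \<comment> \<open>A single late point at which \<open>U\<close> and \<open>H\<close> are both
    small, so that increments up to \<open>t\<close> can be read as values at
    \<open>r\<close>.\<close>
  have late: "\<exists>t\<in>?J. r \<le> t \<and> \<bar>U t\<bar> \<le> e \<and> H t \<le> e" if r: "r \<in> ?J" and e: "0 < e" for r e
  proof -
    obtain t1 where t1: "t1 \<in> ?J" "\<And>t. t \<in> ?J \<Longrightarrow> t1 \<le> t \<Longrightarrow> \<bar>U t\<bar> \<le> e" using U_small[OF e] by blast
    obtain t2 where t2: "t2 \<in> ?J" "\<xi> < t2" "H t2 < e" using H_small[OF e] by blast
    define t where "t = max r (max t1 t2)"
    have t: "t \<in> ?J" "r \<le> t" "t1 \<le> t" "t2 \<le> t" using r t1 t2 by (auto simp: t_def max_def)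
    then show ?thesis using t1(2)[of t] H_antimono[of t2 t] t2 by (intro bexI[of _ t]) auto
  qed
  have Ub: "c1 * H r \<le> \<bar>U r\<bar>" "\<bar>U r\<bar> \<le> c2 * H r" if r: "r \<in> ?J" "a \<le> r" for r
  proof -
    show "c1 * H r \<le> \<bar>U r\<bar>"
    proof (rule field_le_epsilon)
      fix e :: real assume "0 < e"
      \<comment> \<open>The error is \<open>\<bar>U t\<bar> + c1 * H t\<close>, so each of the two
        quantities may use the share \<open>e / (1 + c1)\<close>.\<close>
      then have "0 < e / (1 + c1)" using c by simp
      from late[OF r(1) this] obtain t where t: "t \<in> ?J" "r \<le> t" "\<bar>U t\<bar> \<le> e / (1 + c1)" "H t \<le> e / (1 + c1)" by blast
      have "c1 * H r \<le> \<bar>U t - U r\<bar> + c1 * H t" using inc(1)[OF r t(1,2)] by (simp add: algebra_simps)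
      also have "\<dots> \<le> \<bar>U r\<bar> + e / (1 + c1) + c1 * (e / (1 + c1))"
        using t(3) mult_left_mono[OF t(4), of c1] c by linarith
      also have "\<dots> = \<bar>U r\<bar> + (1 + c1) * (e / (1 + c1))" by (simp add: algebra_simps add_divide_distrib)
      also have "\<dots> = \<bar>U r\<bar> + e" using c by simp
      finally show "c1 * H r \<le> \<bar>U r\<bar> + e" .
    qed
    show "\<bar>U r\<bar> \<le> c2 * H r"
    proof (rule field_le_epsilon)
      fix e :: real assume "0 < e"
      from late[OF r(1) this] obtain t where t: "t \<in> ?J" "r \<le> t" "\<bar>U t\<bar> \<le> e" by blast
      have "0 \<le> c2 * H t" using c H0[of t] by simp
      then have "\<bar>U t - U r\<bar> \<le> c2 * H r" using inc(2)[OF r t(1,2)] by (simp add: algebra_simps)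
      then show "\<bar>U r\<bar> \<le> c2 * H r + e" using t(3) by linarith
    qed
  qed
  have sub: "r \<in> ?J \<and> a \<le> r" if "r \<in> ivl a R2" for r using that a(1) by (auto simp: ivl_def)
  have "R1 < a" "ereal a < R2" using a(1) by (auto simp: ivl_def)
  then show ?thesis
    unfolding \<rho>_def[symmetric] h_def[symmetric] H_def[symmetric]
    using c Ub pt sub by (intro exI[of _ a] exI[of _ c1] exI[of _ c2] exI[of _ c1] exI[of _ c2]) auto
qed

end
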